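(* Let $G,H:\mathbb{R}^n\to\mathbb{R}^m$ be continuously differentiable, let $\mathcal{S}=\{x\in\mathbb{R}^n: G(x)\ge 0,\ H(x)\ge 0,\ G(x)^TH(x)=0\}$ be nonempty with $0\notin\mathcal{S}$, and let $\nu>0$. Let $x^*$ be a local minimizer of the problem $(R_\nu)$: $\min_{x\in\mathcal{S}}\Phi(x)$, where $\Phi(x)=\sum_{i=1}^n\min\{1,|x_i|/\nu\}$. (i) Assume that $\mathcal{S}$ is regular at $x^*$, that is, $\mathcal{N}_{\mathcal{S}}(x^* )=\hat{\mathcal{N}}_{\mathcal{S}}(x^* )$. If MPCC-LICQ holds at $x^*$, then $x^*$ is an S-stationary point of $(R_\nu)$. (ii) If MPCC-NNAMCQ holds at $x^*$, then $x^*$ is an M-stationary point of $(R_\nu)$. (iii) If MPCC-LICQ holds at $x^*$, then $x^*$ is an MPCC d-stationary point of $(R_\nu)$.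
   Context: Inequalities between vectors are componentwise. $\nabla F(x)$ is the transposed Jacobian of a smooth map $F$ at $x$ (so $\nabla G(x),\nabla H(x)\in\mathbb{R}^{n\times m}$), and $\boldsymbol e_i$ is the $i$th standard basis vector of $\mathbb{R}^n$. Normal cones: for a closed set $\Omega$ and $x^*\in\Omega$, the regular normal cone is $\hat{\mathcal{N}}_\Omega(x^* )=\{u: u^T(x-x^* )\le o(\|x-x^*\|)\ \forall x\in\Omega\}$ and the limiting normal cone is $\mathcal{N}_\Omega(x^* )=\{u:\exists\, x^k\in\Omega,\ x^k\to x^*,\ u^k\in\hat{\mathcal{N}}_\Omega(x^k),\ u^k\to u\}$. Subdifferentials: for a continuous $\varphi:\mathbb{R}^n\to\mathbb{R}$, $\hat\partial\varphi(x^* )=\{v:\varphi(x)\ge\varphi(x^* )+v^T(x-x^* )+o(\|x-x^*\|)\ \forall x\}$ and $\partial\varphi(x^* )=\{v:\exists\,x^k\to x^*,\ v^k\in\hat\partial\varphi(x^k),\ v^k\to v\}$ (limiting subdifferential). Index sets, for $x\in\mathcal{S}$: $\mathcal{I}_G(x)=\{i:G_i(x)=0\}$, $\mathcal{I}_H(x)=\{i:H_i(x)=0\}$, $\mathcal{I}_{0+}(x)=\mathcal{I}_G(x)\setminus\mathcal{I}_H(x)$, $\mathcal{I}_{+0}(x)=\mathcal{I}_H(x)\setminus\mathcal{I}_G(x)$, $\mathcal{I}_{00}(x)=\mathcal{I}_G(x)\cap\mathcal{I}_H(x)$. MPCC-LICQ holds at $x^*\in\mathcal{S}$ if the gradients $\{\nabla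 G_i(x^* ):i\in\mathcal{I}_G(x^* )\}\cup\{\nabla H_i(x^* ):i\in\mathcal{I}_H(x^* )\}$ (as a family) are linearly independent. MPCC-NNAMCQ holds at $x^*\in\mathcal{S}$ if there is no nonzero pair $(u,v)\in\mathbb{R}^m\times\mathbb{R}^m$ such that $0=\nabla G(x^* )u+\nabla H(x^* )v$; $u_i=0$ for $i\in\mathcal{I}_{+0}(x^* )$; $v_i=0$ for $i\in\mathcal{I}_{0+}(x^* )$; and, for each $i\in\mathcal{I}_{00}(x^* )$, either $u_i>0,\ v_i>0$ or $u_iv_i=0$. Stationarity: $x^*\in\mathcal{S}$ is M-stationary (respectively S-stationary) for $(R_\nu)$ if there exist $u,v\in\mathbb{R}^m$ such that $0\in\partial\Phi(x^* )-\nabla G(x^* )u-\nabla H(x^* )v$, $u_i=0$ for $i\in\mathcal{I}_{+0}(x^* )$, $v_i=0$ for $i\in\mathcal{I}_{0+}(x^* )$, and for each $i\in\mathcal{I}_{00}(x^* )$: either $u_i>0,v_i>0$ or $u_iv_i=0$ (respectively $u_i\ge0$ and $v_i\ge0$). DC structure: $\min\{1,|t|/\nu\}=|t|/\nu-\max\{\theta_1(t),\theta_2(t),\theta_3(t)\}$ with $\theta_1(t)=0$, $\theta_2(t)=t/\nu-1$, $\theta_3(t)=-t/\nu-1$. For $t\in\mathbb{R}$, $\mathcal{D}(t)=\{i\in\{1,2,3\}:\theta_i(t)=\max\{\theta_1(t),\theta_2(t),\theta_3(t)\}\}$. $x^*\in\mathcal{S}$ is an MPCC d-stationary point of $(R_\nu)$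 if for every $d=(d_1,\dots,d_n)^T$ with $d_i\in\mathcal{D}(x_i^* )$, $i=1,\dots,n$, there exist $u,v\in\mathbb{R}^m$ such that $$0\in\partial\Big(\sum_{i=1}^n\frac{|x_i^*|}{\nu}\Big)-\sum_{i=1}^n\theta_{d_i}'(x_i^* )\boldsymbol e_i-\nabla G(x^* )u-\nabla H(x^* )v,$$ $u_i=0$ for $i\in\mathcal{I}_{+0}(x^* )$, $v_i=0$ for $i\in\mathcal{I}_{0+}(x^* )$, and $u_iv_i\ge0$ for $i\in\mathcal{I}_{00}(x^* )$. Here $\partial(\sum_i|x_i^*|/\nu)$ denotes the subdifferential of $x\mapsto\sum_i|x_i|/\nu$ at $x^*$. *)

theory Defs
  imports "HOL-Analysis.Analysis" "HOL-Library.Landau_Symbols"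
begin

definition continuously_differentiable :: "(real^'n \<Rightarrow> real^'m) \<Rightarrow> bool" where
  "continuously_differentiable F \<longleftrightarrow>
     (\<forall>x. F differentiable (at x)) \<and> continuous_on UNIV (\<lambda>x. jacobian F (at x))"

definition nabla :: "(real^'n \<Rightarrow> real^'m) \<Rightarrow> real^'n \<Rightarrow> real^'m^'n" where
  "nabla F x = transpose (jacobian F (at x))"

definition regular_normal_cone :: "(real^'n) set \<Rightarrow> real^'n \<Rightarrow> (real^'n) set" where
  "regular_normal_cone \<Omega> x0 =
     {u. \<exists>r. r \<in> o[at x0 within \<Omega>](\<lambda>x. norm (x - x0)) \<and> (\<forall>x\<in>\<Omega>. u \<bullet> (x - x0) \<le> r x)}"

definition limiting_normal_cone :: "(real^'n) set \<Rightarrow> real^'n \<Rightarrow> (real^'n) set" where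
  "limiting_normal_cone \<Omega> x0 =
     {u. \<exists>xs us. (\<forall>k::nat. xs k \<in> \<Omega>) \<and> xs \<longlonglongrightarrow> x0 \<and>
                 (\<forall>k. us k \<in> regular_normal_cone \<Omega> (xs k)) \<and> us \<longlonglongrightarrow> u}"

definition regular_subdifferential :: "(real^'n \<Rightarrow> real) \<Rightarrow> real^'n \<Rightarrow> (real^'n) set" where
  "regular_subdifferential \<phi> x0 =
     {v. \<exists>r. r \<in> o[at x0](\<lambda>x. norm (x - x0)) \<and> (\<forall>x. \<phi> x \<ge> \<phi> x0 + v \<bullet> (x - x0) + r x)}"

text \<open>The sequence condition $\varphi(x^k) \to \varphi(x^*)$ of the general definition is omitted:
  it is automatic for continuous functions, the only ones considered here.\<close>

definition limiting_subdifferential :: "(real^'n \<Rightarrow> real) \<Rightarrow> real^'n \<Rightarrow> (real^'n) set" where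
  "limiting_subdifferential \<phi> x0 =
     {v. \<exists>xs vs. xs \<longlonglongrightarrow> x0 \<and>
                 (\<forall>k::nat. vs k \<in> regular_subdifferential \<phi> (xs k)) \<and> vs \<longlonglongrightarrow> v}"

definition local_minimizer :: "('a::metric_space \<Rightarrow> real) \<Rightarrow> 'a set \<Rightarrow> 'a \<Rightarrow> bool" where
  "local_minimizer f S x0 \<longleftrightarrow> x0 \<in> S \<and> (\<exists>\<epsilon>>0. \<forall>x\<in>S \<inter> ball x0 \<epsilon>. f x0 \<le> f x)"

definition feasible_set :: "(real^'n \<Rightarrow> real^'m) \<Rightarrow> (real^'n \<Rightarrow> real^'m) \<Rightarrow> (real^'n) set" where
  "feasible_set G H = {x. (\<forall>i. G x $ i \<ge> 0) \<and> (\<forall>i. H x $ i \<ge> 0) \<and> G x \<bullet> H x = 0}"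

definition Phi :: "real \<Rightarrow> real^'n \<Rightarrow> real" where
  "Phi \<nu> x = (\<Sum>i\<in>UNIV. min 1 (\<bar>x $ i\<bar> / \<nu>))"

definition zero_indices :: "(real^'n \<Rightarrow> real^'m) \<Rightarrow> real^'n \<Rightarrow> 'm set" where
  "zero_indices F x = {i. F x $ i = 0}"

definition I_0p :: "(real^'n \<Rightarrow> real^'m) \<Rightarrow> (real^'n \<Rightarrow> real^'m) \<Rightarrow> real^'n \<Rightarrow> 'm set" where
  "I_0p G H x = zero_indices G x - zero_indices H x"

definition I_p0 :: "(real^'n \<Rightarrow> real^'m) \<Rightarrow> (real^'n \<Rightarrow> real^'m) \<Rightarrow> real^'n \<Rightarrow> 'm set" where
  "I_p0 G H x = zero_indices H x - zero_indices G x"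

definition I_00 :: "(real^'n \<Rightarrow> real^'m) \<Rightarrow> (real^'n \<Rightarrow> real^'m) \<Rightarrow> real^'n \<Rightarrow> 'm set" where
  "I_00 G H x = zero_indices G x \<inter> zero_indices H x"

text \<open>The gradients form a family indexed by a disjoint sum, so coinciding gradients
  (\<^term>\<open>inj_on\<close> failing) count as dependent.  Column $i$ of \<^term>\<open>nabla F x\<close> is the
  gradient of the $i$th component.\<close>

definition MPCC_LICQ :: "(real^'n \<Rightarrow> real^'m) \<Rightarrow> (real^'n \<Rightarrow> real^'m) \<Rightarrow> real^'n \<Rightarrow> bool" where
  "MPCC_LICQ G H x \<longleftrightarrow>
     (let J = zero_indices G x <+> zero_indices H x;
          g = case_sum (\<lambda>i. column i (nabla G x)) (\<lambda>i. column i (nabla H x))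
      in inj_on g J \<and> independent (g ` J))"

definition MPCC_NNAMCQ :: "(real^'n \<Rightarrow> real^'m) \<Rightarrow> (real^'n \<Rightarrow> real^'m) \<Rightarrow> real^'n \<Rightarrow> bool" where
  "MPCC_NNAMCQ G H x \<longleftrightarrow>
     \<not> (\<exists>u v. (u, v) \<noteq> (0, 0) \<and>
          0 = nabla G x *v u + nabla H x *v v \<and>
          (\<forall>i\<in>I_p0 G H x. u $ i = 0) \<and>
          (\<forall>i\<in>I_0p G H x. v $ i = 0) \<and>
          (\<forall>i\<in>I_00 G H x. (u $ i > 0 \<and> v $ i > 0) \<or> u $ i * v $ i = 0))"

definition M_stationary ::
  "real \<Rightarrow> (real^'n \<Rightarrow> real^'m) \<Rightarrow> (real^'n \<Rightarrow> real^'m) \<Rightarrow> real^'n \<Rightarrow> bool" where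
  "M_stationary \<nu> G H x \<longleftrightarrow> x \<in> feasible_set G H \<and>
     (\<exists>u v. 0 \<in> (\<lambda>w. w - nabla G x *v u - nabla H x *v v) ` limiting_subdifferential (Phi \<nu>) x \<and>
        (\<forall>i\<in>I_p0 G H x. u $ i = 0) \<and>
        (\<forall>i\<in>I_0p G H x. v $ i = 0) \<and>
        (\<forall>i\<in>I_00 G H x. (u $ i > 0 \<and> v $ i > 0) \<or> u $ i * v $ i = 0))"

definition S_stationary ::
  "real \<Rightarrow> (real^'n \<Rightarrow> real^'m) \<Rightarrow> (real^'n \<Rightarrow> real^'m) \<Rightarrow> real^'n \<Rightarrow> bool" where
  "S_stationary \<nu> G H x \<longleftrightarrow> x \<in> feasible_set G H \<and>
     (\<exists>u v. 0 \<in> (\<lambda>w. w - nabla G x *v u - nabla H x *v v) ` limiting_subdifferential (Phi \<nu>) x \<and>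
        (\<forall>i\<in>I_p0 G H x. u $ i = 0) \<and>
        (\<forall>i\<in>I_0p G H x. v $ i = 0) \<and>
        (\<forall>i\<in>I_00 G H x. u $ i \<ge> 0 \<and> v $ i \<ge> 0))"

text \<open>Only the indices $1, 2, 3$ are meaningful; every other index falls into the last branch.\<close>

definition theta :: "real \<Rightarrow> nat \<Rightarrow> real \<Rightarrow> real" where
  "theta \<nu> k t = (if k = 1 then 0 else if k = 2 then t / \<nu> - 1 else - t / \<nu> - 1)"

definition active_pieces :: "real \<Rightarrow> real \<Rightarrow> nat set" where
  "active_pieces \<nu> t = {k \<in> {1, 2, 3}. theta \<nu> k t = Max {theta \<nu> 1 t, theta \<nu> 2 t, theta \<nu> 3 t}}"

definition d_stationary ::
  "real \<Rightarrow> (real^'n \<Rightarrow> real^'m) \<Rightarrow> (real^'n \<Rightarrow> real^'m) \<Rightarrow> real^'n \<Rightarrow> bool" where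
  "d_stationary \<nu> G H x \<longleftrightarrow> x \<in> feasible_set G H \<and>
     (\<forall>d. (\<forall>i. d i \<in> active_pieces \<nu> (x $ i)) \<longrightarrow>
       (\<exists>u v. 0 \<in> (\<lambda>w. w - (\<Sum>i\<in>UNIV. deriv (theta \<nu> (d i)) (x $ i) *\<^sub>R axis i 1)
                        - nabla G x *v u - nabla H x *v v) `
                  limiting_subdifferential (\<lambda>y. \<Sum>i\<in>UNIV. \<bar>y $ i\<bar> / \<nu>) x \<and>
          (\<forall>i\<in>I_p0 G H x. u $ i = 0) \<and>
          (\<forall>i\<in>I_0p G H x. v $ i = 0) \<and>
          (\<forall>i\<in>I_00 G H x. u $ i * v $ i \<ge> 0)))"

end

theory Submission
  imports Defs
begin

text \<open>
  Two facts carry the proof. The first is about the objective: it is a finite minimum of convex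
  functions. By the DC decomposition, every choice d of pieces \<open>\<theta>\<close> gives a convex function
  \<open>\<psi>\<^sub>d(x) = \<Sum>\<bar>x\<^sub>i\<bar> / \<nu> - \<Sum>\<theta>\<^bsub>d i\<^esub>(x\<^sub>i)\<close>, up to a constant the weighted 1-norm minus a linear
  form, that majorizes \<open>\<Phi>\<close> and agrees with it at \<open>x\<^sup>*\<close> when every piece is active there. So \<open>x\<^sup>*\<close> is
  also a local minimizer of each such \<open>\<psi>\<^sub>d\<close> (\<open>piece_majorant_local_minimizer\<close>), and multipliers for
  these convex objectives are multipliers for the problem itself: adding the gradient of
  \<open>\<Sum>\<theta>\<^bsub>d i\<^esub>(x\<^sub>i)\<close> to a convex subgradient of \<open>\<psi>\<^sub>d\<close> at \<open>x\<^sup>*\<close> gives an element of the subdifferential in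
  d-stationarity, and for one particular d the subgradients of \<open>\<psi>\<^sub>d\<close> belong to \<open>\<partial>\<Phi>(x\<^sup>*)\<close>
  (\<open>subgradient_of_inner_piece\<close>).

  The second is a quadratic penalty argument for a convex objective \<open>\<psi>\<close> on a set \<open>F\<^sup>-\<^sup>1(C)\<close>, where C is
  closed but need not be convex (\<open>penalty_multipliers\<close>). Minimizers of
  \<open>\<psi> + \<parallel>x - x\<^sup>*\<parallel>\<^sup>2 / 2 + k / 2 dist(F x, C)\<^sup>2\<close> tend to \<open>x\<^sup>*\<close>, and the Fermat rule there yields a convex
  subgradient of \<open>\<psi>\<close> that is, in the limit, the transposed Jacobian applied to multiples of
  \<open>y - F x\<close>, with y a nearest point of C. It is used with two pairs (F, C).

  \<^item> \<open>F = (G, H)\<close> and C a product of closed subsets of the plane. Nearest points can then be computed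
  coordinatewise, which gives the sign conditions; a constraint qualification keeps the multipliers
  from escaping to infinity (\<open>limit_of_multipliers\<close>). When each planar set is the union of the two
  nonnegative half-axes, the signs are those of M-stationarity (\<open>M_multipliers\<close>). For that
  particular d this is (ii), and for arbitrary active d it gives (iii), since LICQ implies NNAMCQ and M-multipliers satisfy \<open>u\<^sub>i v\<^sub>i \<ge> 0\<close> at biactive
  indices.

  \<^item> F the identity and C the feasible set. The negatives of the multiples are then regular normals, so minus some
  convex subgradient of \<open>\<psi>\<close> is a limiting normal (\<open>minimizer_limiting_normal\<close>), hence a regular one under the
  hypothesis of (i).

  For (i) it remains to find S-multipliers for a regular normal w under LICQ
  (\<open>regular_normal_S_multipliers\<close>). By definition of the regular normal cone,
  \<open>x\<^sup>*\<close> minimizes \<open>- w \<bullet> x + \<epsilon> \<parallel>x - x\<^sup>*\<parallel>\<close> locally for every \<open>\<epsilon> > 0\<close>, also over each smaller set in which every pair \<open>(G\<^sub>i(x), H\<^sub>i(x))\<close> is confined to one half-axis, with both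
  choices possible at biactive indices. The branch \<open>G\<^sub>i = 0\<close> gives \<open>v\<^sub>i \<ge> 0\<close>, the branch \<open>H\<^sub>i = 0\<close> gives
  \<open>u\<^sub>i \<ge> 0\<close>, and by LICQ both branches have the same multipliers.
\<close>

section \<open>Subgradients of convex functions\<close>

definition convex_subdifferential :: "('a::real_inner \<Rightarrow> real) \<Rightarrow> 'a \<Rightarrow> 'a set" where
  "convex_subdifferential \<psi> x = {p. \<forall>y. \<psi> x + p \<bullet> (y - x) \<le> \<psi> y}"

text \<open>
  Convexity bounds the growth of \<open>\<psi>\<close> along the segment from x to y by the chord, so local optimality of
  \<open>\<psi> + s\<close> at x bounds the difference quotients of s along the segment below by \<open>\<psi> x - \<psi> y\<close>.
  The resulting inequality is global in y.
\<close>
lemma convex_fermat: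
  fixes \<psi> s :: "'a::real_normed_vector \<Rightarrow> real"
  assumes conv: "convex_on UNIV \<psi>" and der: "(s has_derivative s') (at x)"
    and min: "\<forall>\<^sub>F y in nhds x. \<psi> x + s x \<le> \<psi> y + s y"
  shows "\<psi> x - s' (y - x) \<le> \<psi> y"
proof -
  define h where "h = y - x"
  have lin: "linear s'" using der has_derivative_linear by blast
  have "((\<lambda>t::real. x + t *\<^sub>R h) has_derivative (\<lambda>t. t *\<^sub>R h)) (at 0)"
    by (auto intro!: derivative_eq_intros)
  moreover have "(s has_derivative s') (at (x + 0 *\<^sub>R h))" using der by simp
  ultimately have "((\<lambda>t. s (x + t *\<^sub>R h)) has_derivative (\<lambda>t. s' (t *\<^sub>R h))) (at 0)"
    by (rule has_derivative_compose)
  moreover have "(\<lambda>t. s' (t *\<^sub>R h)) = (*) (s' h)"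
    using lin by (auto simp: linear_scale)
  ultimately have "((\<lambda>t. s (x + t *\<^sub>R h)) has_field_derivative s' h) (at 0)"
    by (simp add: has_field_derivative_def)
  hence "((\<lambda>t. (s (x + t *\<^sub>R h) - s x) / t) \<longlongrightarrow> s' h) (at 0)"
    by (simp add: DERIV_def)
  hence lim: "((\<lambda>t. (s (x + t *\<^sub>R h) - s x) / t) \<longlongrightarrow> s' h) (at_right 0)"
    by (rule filterlim_mono) (auto simp: at_le)
  have "((\<lambda>t. x + t *\<^sub>R h) \<longlongrightarrow> x + 0 *\<^sub>R h) (at_right (0::real))"
    by (intro tendsto_intros)
  hence "filterlim (\<lambda>t. x + t *\<^sub>R h) (nhds x) (at_right (0::real))" by simp
  hence ev: "\<forall>\<^sub>F t in at_right (0::real). \<psi> x + s x \<le> \<psi> (x + t *\<^sub>R h) + s (x + t *\<^sub>R h)"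
    using min unfolding filterlim_iff by blast
  have "\<forall>\<^sub>F t in at_right (0::real). t \<in> {0<..<1}" by (rule eventually_at_right_real) simp
  with ev have "\<forall>\<^sub>F t in at_right (0::real). \<psi> x - \<psi> y \<le> (s (x + t *\<^sub>R h) - s x) / t"
  proof eventually_elim
    case (elim t)
    have "\<psi> ((1 - t) *\<^sub>R x + t *\<^sub>R y) \<le> (1 - t) * \<psi> x + t * \<psi> y"
      using elim convex_onD[OF conv, of t x y] by auto
    moreover have "(1 - t) *\<^sub>R x + t *\<^sub>R y = x + t *\<^sub>R h"
      by (simp add: h_def algebra_simps)
    ultimately have "t * (\<psi> x - \<psi> y) \<le> s (x + t *\<^sub>R h) - s x"
      using elim(1) by (simp add: algebra_simps)
    thus ?case using elim by (simp add: field_simps)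
  qed
  hence "\<psi> x - \<psi> y \<le> s' h"
    using lim by (intro tendsto_lowerbound[OF lim]) auto
  thus ?thesis by (simp add: h_def)
qed

text \<open>
  A convex function is continuous, hence bounded near the points \<open>xs k\<close>; stepping a unit length along a
  subgradient then bounds its norm, and a convergent subsequence exists.
\<close>
lemma convex_subdifferential_limit:
  fixes \<psi> :: "'a::euclidean_space \<Rightarrow> real"
  assumes conv: "convex_on UNIV \<psi>" and x: "xs \<longlonglongrightarrow> x"
    and p: "\<And>k. ps k \<in> convex_subdifferential \<psi> (xs k)"
  obtains p r where "strict_mono (r :: nat \<Rightarrow> nat)" "(ps \<circ> r) \<longlonglongrightarrow> p" "p \<in> convex_subdifferential \<psi> x"
proof -
  have cont: "continuous_on UNIV \<psi>" using conv by (intro convex_on_continuous) auto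
  obtain R where R: "\<And>k. norm (xs k) \<le> R"
    using convergent_imp_Bseq[OF convergentI[OF x]] by (auto elim!: BseqE)
  have "bounded (\<psi> ` cball 0 (R + 1))"
    by (intro compact_imp_bounded compact_continuous_image continuous_on_subset[OF cont]) auto
  then obtain B where "\<forall>z\<in>cball 0 (R + 1). \<bar>\<psi> z\<bar> \<le> B"
    by (auto simp: bounded_iff)
  hence B: "\<bar>\<psi> z\<bar> \<le> B" if "norm z \<le> R + 1" for z using that by simp
  have "norm (ps k) \<le> 2 * B" for k
  proof -
    have "\<psi> (xs k) + ps k \<bullet> (xs k + sgn (ps k) - xs k) \<le> \<psi> (xs k + sgn (ps k))"
      using p[of k] unfolding convex_subdifferential_def by blast
    moreover have "ps k \<bullet> sgn (ps k) = norm (ps k)"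
      by (cases "ps k = 0") (simp_all add: sgn_div_norm dot_square_norm power2_eq_square)
    moreover have "norm (xs k + sgn (ps k)) \<le> R + 1"
      using R[of k] norm_triangle_ineq[of "xs k" "sgn (ps k)"] by (auto simp: norm_sgn split: if_splits)
    hence "\<bar>\<psi> (xs k + sgn (ps k))\<bar> \<le> B" by (rule B)
    moreover have "\<bar>\<psi> (xs k)\<bar> \<le> B" using R[of k] by (intro B) auto
    ultimately show ?thesis by simp
  qed
  hence "bounded (range ps)" by (auto simp: bounded_iff)
  then obtain p r where r: "strict_mono (r::nat\<Rightarrow>nat)" "(ps \<circ> r) \<longlonglongrightarrow> p"
    using bounded_imp_convergent_subsequence by blast
  have xr: "(xs \<circ> r) \<longlonglongrightarrow> x" using LIMSEQ_subseq_LIMSEQ[OF x r(1)] .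
  have "\<psi> x + p \<bullet> (y - x) \<le> \<psi> y" for y
  proof (rule tendsto_upperbound)
    have "(\<lambda>k. \<psi> ((xs \<circ> r) k)) \<longlonglongrightarrow> \<psi> x"
      using continuous_on_tendsto_compose[OF cont xr] by simp
    thus "(\<lambda>k. \<psi> ((xs \<circ> r) k) + (ps \<circ> r) k \<bullet> (y - (xs \<circ> r) k)) \<longlonglongrightarrow> \<psi> x + p \<bullet> (y - x)"
      by (intro tendsto_intros xr r(2))
    show "\<forall>\<^sub>F k in sequentially. \<psi> ((xs \<circ> r) k) + (ps \<circ> r) k \<bullet> (y - (xs \<circ> r) k) \<le> \<psi> y"
      using p by (auto simp: convex_subdifferential_def)
  qed simp
  hence "p \<in> convex_subdifferential \<psi> x" by (simp add: convex_subdifferential_def)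
  with r that show ?thesis by blast
qed

section \<open>Quadratic penalization of a closed constraint\<close>

text \<open>
  The proximal term \<open>\<parallel>x - a\<parallel>\<^sup>2 / 2\<close> makes \<open>a\<close> a strict minimizer. Without it the penalized minimizers
  could converge to a different minimizer of the constrained problem.
\<close>
lemma penalized_minimizers:
  fixes F :: "'a::euclidean_space \<Rightarrow> 'b::euclidean_space" and \<psi> :: "'a \<Rightarrow> real"
  assumes contF: "continuous_on UNIV F" and cont: "continuous_on UNIV \<psi>"
    and C: "closed C" and a: "F a \<in> C" and e: "e > 0"
    and min: "\<forall>x\<in>ball a e. F x \<in> C \<longrightarrow> \<psi> a \<le> \<psi> x"
  shows "\<exists>xs cs. xs \<longlonglongrightarrow> a \<and> (\<forall>k::nat. 0 < cs k) \<and>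
    (\<forall>k. \<forall>\<^sub>F x in nhds (xs k).
       \<psi> (xs k) + (norm (xs k - a))\<^sup>2 / 2 + cs k / 2 * (infdist (F (xs k)) C)\<^sup>2
       \<le> \<psi> x + (norm (x - a))\<^sup>2 / 2 + cs k / 2 * (infdist (F x) C)\<^sup>2) \<and>
    (\<lambda>k. infdist (F (xs k)) C) \<longlonglongrightarrow> 0"
proof -
  (* Half the radius, so that K is compact and still lies in the region of local optimality. *)
  define K where "K = cball a (e / 2)"
  have K: "compact K" "a \<in> K" "K \<subseteq> ball a e" using e by (auto simp: K_def)
  define q where "q k x = \<psi> x + (norm (x - a))\<^sup>2 / 2 + real (Suc k) / 2 * (infdist (F x) C)\<^sup>2" for k x
  have contI: "continuous_on UNIV (\<lambda>x. infdist (F x) C)"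
    by (intro continuous_on_infdist contF)
  have "continuous_on K (q k)" for k unfolding q_def
    by (intro continuous_intros continuous_on_subset[OF cont] continuous_on_subset[OF contI]) auto
  hence "\<exists>x\<in>K. \<forall>y\<in>K. q k x \<le> q k y" for k
    using continuous_attains_inf[of K "q k"] K by auto
  then obtain X where X: "\<And>k. X k \<in> K" "\<And>k y. y \<in> K \<Longrightarrow> q k (X k) \<le> q k y" by metis
  have qa: "q k a = \<psi> a" for k using a by (simp add: q_def)
  have Xa: "q k (X k) \<le> \<psi> a" for k using X(2)[of a k] K(2) qa by simp
  have "bounded (\<psi> ` K)"
    by (intro compact_imp_bounded compact_continuous_image continuous_on_subset[OF cont] K) auto
  then obtain B where B: "\<And>z. z \<in> K \<Longrightarrow> \<bar>\<psi> z\<bar> \<le> B"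
    by (auto simp: bounded_iff)
  have I: "(infdist (F (X k)) C)\<^sup>2 \<le> 4 * B / real (Suc k)" for k
  proof -
    have "real (Suc k) / 2 * (infdist (F (X k)) C)\<^sup>2 \<le> \<psi> a - \<psi> (X k)"
      using Xa[of k] zero_le_power2[of "norm (X k - a)"] unfolding q_def by linarith
    also have "\<dots> \<le> 2 * B" using B[OF X(1)[of k]] B[OF K(2)] by linarith
    finally show ?thesis by (simp add: field_simps)
  qed
  have "(\<lambda>k. 4 * B / real (Suc k)) \<longlonglongrightarrow> 0"
    using LIMSEQ_Suc[OF lim_const_over_n[of "4 * B"]] by simp
  hence "(\<lambda>k. (infdist (F (X k)) C)\<^sup>2) \<longlonglongrightarrow> 0"
    by (rule tendsto_sandwich[OF _ _ tendsto_const, rotated 2]) (use I in auto)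
  hence I0: "(\<lambda>k. infdist (F (X k)) C) \<longlonglongrightarrow> 0"
    using tendsto_real_sqrt[of _ 0] by (fastforce simp: infdist_nonneg)
  obtain x r where x: "x \<in> K" "strict_mono (r::nat\<Rightarrow>nat)" "(X \<circ> r) \<longlonglongrightarrow> x"
    using K(1) X(1) unfolding compact_def by metis
  have "(\<lambda>k. infdist (F ((X \<circ> r) k)) C) \<longlonglongrightarrow> infdist (F x) C"
    using continuous_on_tendsto_compose[OF contI x(3)] by simp
  moreover have "(\<lambda>k. infdist (F ((X \<circ> r) k)) C) \<longlonglongrightarrow> 0"
    using LIMSEQ_subseq_LIMSEQ[OF I0 x(2)] by (simp add: o_def)
  ultimately have "infdist (F x) C = 0" using LIMSEQ_unique by blast
  hence "F x \<in> C" using C a in_closed_iff_infdist_zero by blast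
  hence "\<psi> a \<le> \<psi> x" using min K x by blast
  moreover have "\<psi> x + (norm (x - a))\<^sup>2 / 2 \<le> \<psi> a"
  proof (rule tendsto_upperbound)
    have "(\<lambda>k. \<psi> ((X \<circ> r) k)) \<longlonglongrightarrow> \<psi> x"
      using continuous_on_tendsto_compose[OF cont x(3)] by simp
    thus "(\<lambda>k. \<psi> ((X \<circ> r) k) + (norm ((X \<circ> r) k - a))\<^sup>2 / 2) \<longlonglongrightarrow> \<psi> x + (norm (x - a))\<^sup>2 / 2"
      by (intro tendsto_intros x(3)) auto
    have "\<psi> (X k) + (norm (X k - a))\<^sup>2 / 2 \<le> \<psi> a" for k
    proof -
      have "0 \<le> real (Suc k) / 2 * (infdist (F (X k)) C)\<^sup>2" by simp
      thus ?thesis using Xa[of k] unfolding q_def by linarith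
    qed
    thus "\<forall>\<^sub>F k in sequentially. \<psi> ((X \<circ> r) k) + (norm ((X \<circ> r) k - a))\<^sup>2 / 2 \<le> \<psi> a" by simp
  qed simp
  ultimately have "x = a" by (smt (verit) half_gt_zero norm_eq_zero zero_eq_power2 zero_le_power2 right_minus_eq)
  with x have lim: "(X \<circ> r) \<longlonglongrightarrow> a" by simp
  (* Near a the ball no longer constrains the minimizers, so they are unconstrained local ones. *)
  have "\<forall>\<^sub>F k in sequentially. (X \<circ> r) k \<in> ball a (e / 2)"
    using topological_tendstoD[OF lim open_ball, of a "e / 2"] e by simp
  then obtain N where "\<forall>k\<ge>N. X (r k) \<in> ball a (e / 2)"
    by (auto simp: eventually_sequentially)
  hence N: "X (r (k + N)) \<in> ball a (e / 2)" for k by simp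
  define s where "s k = r (k + N)" for k
  have s: "strict_mono s" using x(2) by (simp add: s_def strict_mono_def)
  show ?thesis
  proof (intro exI[of _ "X \<circ> s"] exI[of _ "\<lambda>k. real (Suc (s k))"] conjI allI)
    show "(X \<circ> s) \<longlonglongrightarrow> a" using LIMSEQ_ignore_initial_segment[OF lim, of N] by (simp add: s_def o_def)
    show "(\<lambda>k. infdist (F ((X \<circ> s) k)) C) \<longlonglongrightarrow> 0"
      using LIMSEQ_subseq_LIMSEQ[OF I0 s] by (simp add: o_def)
    fix k
    have "\<forall>\<^sub>F x in nhds (X (s k)). x \<in> ball a (e / 2)"
      using N[of k] by (intro eventually_nhds_in_open) (auto simp: s_def)
    hence "\<forall>\<^sub>F x in nhds (X (s k)). q (s k) (X (s k)) \<le> q (s k) x"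
      by eventually_elim (auto intro!: X(2) simp: K_def)
    thus "\<forall>\<^sub>F x in nhds ((X \<circ> s) k).
       \<psi> ((X \<circ> s) k) + (norm ((X \<circ> s) k - a))\<^sup>2 / 2 + real (Suc (s k)) / 2 * (infdist (F ((X \<circ> s) k)) C)\<^sup>2
       \<le> \<psi> x + (norm (x - a))\<^sup>2 / 2 + real (Suc (s k)) / 2 * (infdist (F x) C)\<^sup>2"
      by (simp add: q_def)
  qed auto
qed

text \<open>
  These are optimality conditions in sequential form. The squared distance
  to C is not differentiable in general, but replacing it by the squared distance to the nearest
  point \<open>ys k\<close> gives a smooth majorant that is exact at \<open>xs k\<close>, so that the Fermat rule applies.
\<close>
lemma penalty_multipliers:
  fixes F :: "'a::euclidean_space \<Rightarrow> 'b::euclidean_space" and \<psi> :: "'a \<Rightarrow> real"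
  assumes F: "\<And>x. (F has_derivative F' x) (at x)" and conv: "convex_on UNIV \<psi>"
    and C: "closed C" and a: "F a \<in> C" and e: "e > 0"
    and min: "\<forall>x\<in>ball a e. F x \<in> C \<longrightarrow> \<psi> a \<le> \<psi> x"
  shows "\<exists>p xs ys cs. p \<in> convex_subdifferential \<psi> a \<and> xs \<longlonglongrightarrow> a \<and> ys \<longlonglongrightarrow> F a \<and>
    (\<forall>k::nat. ys k \<in> C \<and> 0 < cs k \<and> (\<forall>z\<in>C. dist (F (xs k)) (ys k) \<le> dist (F (xs k)) z)) \<and>
    (\<lambda>k. adjoint (F' (xs k)) (cs k *\<^sub>R (ys k - F (xs k)))) \<longlonglongrightarrow> p"
proof -
  have contF: "continuous_on UNIV F"
    using F by (auto intro!: differentiable_imp_continuous_on differentiable_at_imp_differentiable_on differentiableI)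
  have cont: "continuous_on UNIV \<psi>" using conv by (intro convex_on_continuous) auto
  from penalized_minimizers[OF contF cont C a e min]
  obtain xs cs where xs: "xs \<longlonglongrightarrow> a" and cs: "\<forall>k::nat. 0 < cs k"
    and opt: "\<forall>k. \<forall>\<^sub>F x in nhds (xs k).
       \<psi> (xs k) + (norm (xs k - a))\<^sup>2 / 2 + cs k / 2 * (infdist (F (xs k)) C)\<^sup>2
       \<le> \<psi> x + (norm (x - a))\<^sup>2 / 2 + cs k / 2 * (infdist (F x) C)\<^sup>2"
    and inf0: "(\<lambda>k. infdist (F (xs k)) C) \<longlonglongrightarrow> 0"
    by (elim exE conjE) (rule that)
  have "\<exists>y\<in>C. \<forall>z\<in>C. dist (F (xs k)) y \<le> dist (F (xs k)) z" for k
    by (rule distance_attains_inf[OF C, of "F (xs k)"]) (use a in auto)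
  then obtain ys where ys: "\<And>k. ys k \<in> C"
    "\<And>k z. z \<in> C \<Longrightarrow> dist (F (xs k)) (ys k) \<le> dist (F (xs k)) z" by metis
  have inf: "infdist (F (xs k)) C = dist (F (xs k)) (ys k)" for k
  proof (rule antisym)
    show "infdist (F (xs k)) C \<le> dist (F (xs k)) (ys k)" using ys(1) by (rule infdist_le)
    obtain z where "z \<in> C" "infdist (F (xs k)) C = dist (F (xs k)) z"
      using infdist_attains_inf[OF C] a by blast
    thus "dist (F (xs k)) (ys k) \<le> infdist (F (xs k)) C" using ys(2) by simp
  qed
  define \<eta> where "\<eta> k = cs k *\<^sub>R (ys k - F (xs k))" for k
  define P where "P k = adjoint (F' (xs k)) (\<eta> k) - (xs k - a)" for k
  have P: "P k \<in> convex_subdifferential \<psi> (xs k)" for k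
    unfolding convex_subdifferential_def
  proof (safe)
    fix y
    define s where "s x = ((x - a) \<bullet> (x - a)) / 2 + cs k / 2 * ((F x - ys k) \<bullet> (F x - ys k))" for x
    have der: "(s has_derivative (\<lambda>h. (xs k - a) \<bullet> h - \<eta> k \<bullet> F' (xs k) h)) (at (xs k))"
      unfolding s_def \<eta>_def
      by (auto intro!: derivative_eq_intros F simp: inner_commute algebra_simps diff_divide_distrib add_divide_distrib fun_eq_iff)
    have "\<forall>\<^sub>F x in nhds (xs k). \<psi> (xs k) + s (xs k) \<le> \<psi> x + s x"
      using opt[rule_format, of k]
    proof eventually_elim
      case (elim x)
      have "(infdist (F x) C)\<^sup>2 \<le> (dist (F x) (ys k))\<^sup>2"
        using ys(1)[of k] by (intro power_mono infdist_le infdist_nonneg)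
      hence "cs k / 2 * (infdist (F x) C)\<^sup>2 \<le> cs k / 2 * (dist (F x) (ys k))\<^sup>2"
        using cs[rule_format, of k] by (intro mult_left_mono) auto
      with elim show ?case unfolding inf s_def dist_norm by (simp add: power2_norm_eq_inner)
    qed
    from convex_fermat[OF conv der this, of y]
    have "\<psi> (xs k) - ((xs k - a) \<bullet> (y - xs k) - \<eta> k \<bullet> F' (xs k) (y - xs k)) \<le> \<psi> y" .
    moreover have "adjoint (F' (xs k)) (\<eta> k) \<bullet> (y - xs k) = \<eta> k \<bullet> F' (xs k) (y - xs k)"
      using adjoint_works[OF has_derivative_linear[OF F], of "y - xs k" "xs k" "\<eta> k"]
      by (simp add: inner_commute)
    ultimately show "\<psi> (xs k) + P k \<bullet> (y - xs k) \<le> \<psi> y"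
      by (simp add: P_def inner_diff_left)
  qed
  obtain p r where r: "strict_mono (r::nat\<Rightarrow>nat)" "(P \<circ> r) \<longlonglongrightarrow> p" "p \<in> convex_subdifferential \<psi> a"
    using convex_subdifferential_limit[OF conv xs P] by blast
  have xr: "(xs \<circ> r) \<longlonglongrightarrow> a" using LIMSEQ_subseq_LIMSEQ[OF xs r(1)] .
  have "(\<lambda>k. F (xs k)) \<longlonglongrightarrow> F a"
    using continuous_on_tendsto_compose[OF contF xs] by simp
  moreover have "(\<lambda>k. ys k - F (xs k)) \<longlonglongrightarrow> 0"
    by (rule tendsto_norm_zero_cancel) (use inf0 in \<open>simp add: inf dist_norm norm_minus_commute\<close>)
  ultimately have ylim: "ys \<longlonglongrightarrow> F a" by (rule Lim_transform)
  show ?thesis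
  proof (intro exI[of _ p] exI[of _ "xs \<circ> r"] exI[of _ "ys \<circ> r"] exI[of _ "cs \<circ> r"] conjI allI ballI)
    show "(ys \<circ> r) \<longlonglongrightarrow> F a" using LIMSEQ_subseq_LIMSEQ[OF ylim r(1)] .
    have "(\<lambda>k. (P \<circ> r) k + ((xs \<circ> r) k - a)) \<longlonglongrightarrow> p + (a - a)"
      by (intro tendsto_intros r xr)
    thus "(\<lambda>k. adjoint (F' ((xs \<circ> r) k)) ((cs \<circ> r) k *\<^sub>R ((ys \<circ> r) k - F ((xs \<circ> r) k)))) \<longlonglongrightarrow> p"
      by (simp add: P_def \<eta>_def)
  qed (use r xr ys cs in auto)
qed

section \<open>Limits of multipliers in a closed cone\<close>

text \<open>
  Only the images of the multipliers are known to converge. The pairs \<open>(t, t \<cdot> \<eta>)\<close> with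
  \<open>t = 1 / (1 + \<parallel>\<eta>\<parallel>)\<close> are bounded and have a limit \<open>(\<tau>, \<mu>)\<close> along a subsequence, with \<open>A \<mu> = \<tau> \<cdot> p\<close>. If \<open>\<tau> = 0\<close>,
  then \<open>\<mu>\<close> is a unit vector of the cone in the kernel of A, which the constraint qualification
  excludes; otherwise \<open>\<mu> / \<tau>\<close> is the multiplier sought.
\<close>
lemma limit_of_multipliers:
  fixes T :: "nat \<Rightarrow> 'b::euclidean_space \<Rightarrow> 'a::real_normed_vector"
  assumes lin: "\<And>k. linear (T k)" and linA: "linear A"
    and conv: "\<And>r \<mu>s \<mu>. strict_mono r \<Longrightarrow> \<mu>s \<longlonglongrightarrow> \<mu> \<Longrightarrow> (\<lambda>k. T (r k) (\<mu>s k)) \<longlonglongrightarrow> A \<mu>"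
    and K: "closed K" "\<And>c z. 0 \<le> c \<Longrightarrow> z \<in> K \<Longrightarrow> c *\<^sub>R z \<in> K"
    and cq: "\<And>z. z \<in> K \<Longrightarrow> A z = 0 \<Longrightarrow> z = 0"
    and \<eta>: "\<And>k. \<eta>s k \<in> K" "(\<lambda>k. T k (\<eta>s k)) \<longlonglongrightarrow> p"
  shows "p \<in> A ` K"
proof -
  define t where "t k = 1 / (1 + norm (\<eta>s k))" for k
  have t: "0 < t k" "t k \<le> 1" "norm (t k *\<^sub>R \<eta>s k) = 1 - t k" for k
  proof -
    have *: "1 + norm (\<eta>s k) > 0" by (smt (verit) norm_ge_zero)
    thus "0 < t k" "t k \<le> 1" by (auto simp: t_def)
    show "norm (t k *\<^sub>R \<eta>s k) = 1 - t k" using * by (simp add: t_def field_simps)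
  qed
  have "norm (t k, t k *\<^sub>R \<eta>s k) \<le> 2" for k
    using norm_Pair_le[of "t k" "t k *\<^sub>R \<eta>s k"] t[of k] by simp
  hence "bounded (range (\<lambda>k. (t k, t k *\<^sub>R \<eta>s k)))" unfolding bounded_iff by blast
  then obtain l r where r: "strict_mono (r::nat\<Rightarrow>nat)" "((\<lambda>k. (t k, t k *\<^sub>R \<eta>s k)) \<circ> r) \<longlonglongrightarrow> l"
    using bounded_imp_convergent_subsequence by blast
  obtain \<tau> \<mu> where "l = (\<tau>, \<mu>)" by (cases l)
  with r have tl: "(\<lambda>k. t (r k)) \<longlonglongrightarrow> \<tau>" and ml: "(\<lambda>k. t (r k) *\<^sub>R \<eta>s (r k)) \<longlonglongrightarrow> \<mu>"
    using tendsto_fst[OF r(2)] tendsto_snd[OF r(2)] by (auto simp: o_def)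
  have \<mu>K: "\<mu> \<in> K"
    using K(1) _ ml by (rule closed_sequentially) (use K(2)[OF less_imp_le[OF t(1)] \<eta>(1)] in blast)
  have "(\<lambda>k. T (r k) (t (r k) *\<^sub>R \<eta>s (r k))) \<longlonglongrightarrow> A \<mu>" using conv[OF r(1) ml] .
  moreover have "(\<lambda>k. T (r k) (t (r k) *\<^sub>R \<eta>s (r k))) \<longlonglongrightarrow> \<tau> *\<^sub>R p"
    using tendsto_scaleR[OF tl LIMSEQ_subseq_LIMSEQ[OF \<eta>(2) r(1)]]
    by (simp add: o_def linear_scale[OF lin])
  ultimately have A\<mu>: "A \<mu> = \<tau> *\<^sub>R p" using LIMSEQ_unique by blast
  have "norm \<mu> = 1 - \<tau>"
  proof (rule LIMSEQ_unique)
    show "(\<lambda>k. norm (t (r k) *\<^sub>R \<eta>s (r k))) \<longlonglongrightarrow> norm \<mu>" by (intro tendsto_intros ml)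
    show "(\<lambda>k. norm (t (r k) *\<^sub>R \<eta>s (r k))) \<longlonglongrightarrow> 1 - \<tau>"
      unfolding t(3) by (intro tendsto_intros tl)
  qed
  hence "\<tau> \<noteq> 0" using cq[OF \<mu>K] A\<mu> by auto
  moreover have "\<tau> \<ge> 0" using tl by (rule LIMSEQ_le_const) (use t(1) less_imp_le in blast)
  ultimately have "\<tau> > 0" by simp
  show ?thesis
  proof
    show "(1 / \<tau>) *\<^sub>R \<mu> \<in> K" using \<open>\<tau> > 0\<close> \<mu>K by (intro K) auto
    show "p = A ((1 / \<tau>) *\<^sub>R \<mu>)" using \<open>\<tau> > 0\<close> A\<mu> by (simp add: linear_scale[OF linA])
  qed
qed

section \<open>Constraints that split into planar ones\<close>

definition multiplier_gradient ::
  "(real^'n \<Rightarrow> real^'m) \<Rightarrow> (real^'n \<Rightarrow> real^'m) \<Rightarrow> real^'n \<Rightarrow> (real^'m) \<times> (real^'m) \<Rightarrow> real^'n" where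
  "multiplier_gradient G H x \<mu> = nabla G x *v fst \<mu> + nabla H x *v snd \<mu>"

lemma linear_multiplier_gradient: "linear (multiplier_gradient G H x)"
  by (rule linearI) (simp_all add: multiplier_gradient_def matrix_vector_right_distrib
      vec.scale matrix_vector_mult_scaleR scaleR_add_right)

lemma multiplier_gradient_swap:
  "multiplier_gradient H G x (v, u) = multiplier_gradient G H x (u, v)"
  by (simp add: multiplier_gradient_def add.commute)

lemma tendsto_matrix_vector_mult:
  fixes A :: "'b \<Rightarrow> real^'n^'m"
  assumes "(A \<longlongrightarrow> A0) net" "(z \<longlongrightarrow> z0) net"
  shows "((\<lambda>k. A k *v z k) \<longlongrightarrow> A0 *v z0) net"
  unfolding matrix_vector_mult_def
  by (intro vec_tendstoI) (simp add: assms tendsto_intros tendsto_vec_nth)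

lemma continuously_differentiable_has_derivative:
  assumes "continuously_differentiable F"
  shows "(F has_derivative (*v) (jacobian F (at x))) (at x)"
  using assms by (simp add: continuously_differentiable_def flip: jacobian_works)

lemma continuously_differentiable_imp_continuous_on:
  assumes "continuously_differentiable F"
  shows "continuous_on S F"
  using assms unfolding continuously_differentiable_def
  by (intro differentiable_imp_continuous_on differentiable_at_imp_differentiable_on) auto

lemma tendsto_nabla:
  assumes "continuously_differentiable F" "xs \<longlonglongrightarrow> x"
  shows "(\<lambda>k. nabla F (xs k)) \<longlonglongrightarrow> nabla F x"
proof -
  have "(\<lambda>k. jacobian F (at (xs k))) \<longlonglongrightarrow> jacobian F (at x)"
    using assms continuous_on_tendsto_compose[of UNIV "\<lambda>x. jacobian F (at x)"]
    by (simp add: continuously_differentiable_def)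
  thus ?thesis unfolding nabla_def transpose_def
    by (intro vec_tendstoI) (simp add: tendsto_vec_nth)
qed

lemma tendsto_multiplier_gradient:
  assumes "continuously_differentiable G" "continuously_differentiable H" "xs \<longlonglongrightarrow> x" "\<mu>s \<longlonglongrightarrow> \<mu>"
  shows "(\<lambda>k. multiplier_gradient G H (xs k) (\<mu>s k)) \<longlonglongrightarrow> multiplier_gradient G H x \<mu>"
  unfolding multiplier_gradient_def
  by (intro tendsto_add tendsto_matrix_vector_mult tendsto_nabla tendsto_fst tendsto_snd assms)

lemma dist_pair_vec:
  fixes p q :: "(real^'m) \<times> (real^'m)"
  shows "(dist p q)\<^sup>2 = (\<Sum>j\<in>UNIV. (dist (fst p $ j, snd p $ j) (fst q $ j, snd q $ j))\<^sup>2)"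
  by (simp add: dist_prod_def dist_vec_def L2_set_def sum_nonneg sum.distrib)

text \<open>
  A competitor for the i-th planar problem is spliced into q; the other coordinates contribute equally
  to both squared distances.
\<close>
lemma nearest_point_componentwise:
  fixes b q :: "(real^'m) \<times> (real^'m)"
  assumes q: "\<And>j. (fst q $ j, snd q $ j) \<in> D j"
    and near: "\<And>q'. (\<And>j. (fst q' $ j, snd q' $ j) \<in> D j) \<Longrightarrow> dist b q \<le> dist b q'"
    and z: "z \<in> D i"
  shows "dist (fst b $ i, snd b $ i) (fst q $ i, snd q $ i) \<le> dist (fst b $ i, snd b $ i) z"
proof -
  define q' :: "(real^'m) \<times> (real^'m)" where
    "q' = (\<chi> j. if j = i then fst z else fst q $ j, \<chi> j. if j = i then snd z else snd q $ j)"
  define d where "d q j = (dist (fst b $ j, snd b $ j) (fst q $ j, snd q $ j))\<^sup>2"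
    for q :: "(real^'m) \<times> (real^'m)" and j
  have "(dist b q)\<^sup>2 \<le> (dist b q')\<^sup>2"
    using q z by (intro power_mono near) (auto simp: q'_def)
  hence "(\<Sum>j\<in>UNIV. d q j) \<le> (\<Sum>j\<in>UNIV. d q' j)" by (simp add: dist_pair_vec d_def)
  moreover have "(\<Sum>j\<in>UNIV - {i}. d q' j) = (\<Sum>j\<in>UNIV - {i}. d q j)"
    by (intro sum.cong) (auto simp: d_def q'_def)
  ultimately have "d q i \<le> d q' i" by (simp add: sum.remove[of UNIV i])
  thus ?thesis by (simp add: d_def q'_def)
qed

text \<open>
  The cone \<open>N i\<close> contains the directions \<open>q - b\<close> from planar points b to their nearest points q of \<open>D i\<close>,
  as long as q stays close to the base point \<open>(G\<^sub>i(a), H\<^sub>i(a))\<close>. Since \<open>N i\<close> is a closed cone, the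
  multipliers of \<open>penalty_multipliers\<close> eventually satisfy these conditions and pass them to the limit.
\<close>
lemma componentwise_constraint_multipliers:
  fixes G H :: "real^'n \<Rightarrow> real^'m" and D N :: "'m \<Rightarrow> (real \<times> real) set"
  assumes G: "continuously_differentiable G" and H: "continuously_differentiable H"
    and conv: "convex_on UNIV \<psi>"
    and D: "\<And>i. closed (D i)" "\<And>i. (G a $ i, H a $ i) \<in> D i"
    and N: "\<And>i. closed (N i)" "\<And>i c z. 0 \<le> c \<Longrightarrow> z \<in> N i \<Longrightarrow> c *\<^sub>R z \<in> N i"
    and normal: "\<And>i. \<exists>\<delta>>0. \<forall>q \<in> D i \<inter> ball (G a $ i, H a $ i) \<delta>. \<forall>b.
        (\<forall>q'\<in>D i. dist b q \<le> dist b q') \<longrightarrow> q - b \<in> N i"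
    and cq: "\<And>\<mu>. \<forall>i. (fst \<mu> $ i, snd \<mu> $ i) \<in> N i \<Longrightarrow> multiplier_gradient G H a \<mu> = 0 \<Longrightarrow> \<mu> = 0"
    and e: "e > 0" and min: "\<forall>x\<in>ball a e. (\<forall>i. (G x $ i, H x $ i) \<in> D i) \<longrightarrow> \<psi> a \<le> \<psi> x"
  shows "\<exists>\<mu>. multiplier_gradient G H a \<mu> \<in> convex_subdifferential \<psi> a \<and> (\<forall>i. (fst \<mu> $ i, snd \<mu> $ i) \<in> N i)"
proof -
  define C :: "((real^'m) \<times> (real^'m)) set" where "C = {q. \<forall>i. (fst q $ i, snd q $ i) \<in> D i}"
  define F where "F x = (G x, H x)" for x
  define F' where "F' x h = (jacobian G (at x) *v h, jacobian H (at x) *v h)" for x h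
  have closed_comp: "closed {q :: (real^'m) \<times> (real^'m). \<forall>i. (fst q $ i, snd q $ i) \<in> E i}"
    if "\<And>i. closed (E i)" for E :: "'m \<Rightarrow> (real \<times> real) set"
  proof (rule closed_Collect_all)
    fix i
    have "continuous_on UNIV (\<lambda>q :: (real^'m) \<times> (real^'m). (fst q $ i, snd q $ i))"
      by (intro continuous_intros)
    thus "closed {q :: (real^'m) \<times> (real^'m). (fst q $ i, snd q $ i) \<in> E i}"
      using closed_vimage[OF that[of i]] by (simp add: vimage_def)
  qed
  have F: "(F has_derivative F' x) (at x)" for x
    unfolding F_def F'_def
    using G H by (intro has_derivative_Pair continuously_differentiable_has_derivative)
  have adj: "adjoint (F' x) = multiplier_gradient G H x" for x
    by (rule adjoint_unique)
      (simp add: F'_def multiplier_gradient_def nabla_def inner_prod_def inner_add_right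
        flip: adjoint_matrix adjoint_works[OF matrix_vector_mul_linear])
  have C: "closed C" "F a \<in> C" using D closed_comp[OF D(1)] by (auto simp: C_def F_def)
  have "\<forall>x\<in>ball a e. F x \<in> C \<longrightarrow> \<psi> a \<le> \<psi> x" using min by (simp add: C_def F_def)
  from penalty_multipliers[OF F conv C e this]
  obtain p xs ys cs where p: "p \<in> convex_subdifferential \<psi> a" and xs: "xs \<longlonglongrightarrow> a" and ys: "ys \<longlonglongrightarrow> F a"
    and proj: "\<forall>k::nat. ys k \<in> C \<and> 0 < cs k \<and> (\<forall>z\<in>C. dist (F (xs k)) (ys k) \<le> dist (F (xs k)) z)"
    and lim: "(\<lambda>k. adjoint (F' (xs k)) (cs k *\<^sub>R (ys k - F (xs k)))) \<longlonglongrightarrow> p"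
    by (elim exE conjE) (rule that)
  hence ysC: "\<And>k. ys k \<in> C" and cs: "\<And>k. 0 < cs k"
    and near: "\<And>k z. z \<in> C \<Longrightarrow> dist (F (xs k)) (ys k) \<le> dist (F (xs k)) z"
    by auto
  define \<mu>s where "\<mu>s k = cs k *\<^sub>R (ys k - F (xs k))" for k
  have "\<forall>\<^sub>F k in sequentially. (fst (\<mu>s k) $ i, snd (\<mu>s k) $ i) \<in> N i" for i
  proof -
    obtain \<delta> where "\<delta> > 0" and \<delta>: "\<And>q b. q \<in> D i \<Longrightarrow> q \<in> ball (G a $ i, H a $ i) \<delta> \<Longrightarrow>
        (\<forall>q'\<in>D i. dist b q \<le> dist b q') \<Longrightarrow> q - b \<in> N i"
      using normal[of i] by blast
    have "(\<lambda>k. (fst (ys k) $ i, snd (ys k) $ i)) \<longlonglongrightarrow> (fst (F a) $ i, snd (F a) $ i)"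
      by (intro tendsto_intros ys)
    from topological_tendstoD[OF this open_ball, of "(G a $ i, H a $ i)" \<delta>]
    have "\<forall>\<^sub>F k in sequentially. (fst (ys k) $ i, snd (ys k) $ i) \<in> ball (G a $ i, H a $ i) \<delta>"
      using \<open>\<delta> > 0\<close> by (simp add: F_def)
    thus ?thesis
    proof eventually_elim
      case (elim k)
      have "(fst (ys k) $ i, snd (ys k) $ i) - (fst (F (xs k)) $ i, snd (F (xs k)) $ i) \<in> N i"
      proof (rule \<delta>[OF _ elim], safe)
        show "(fst (ys k) $ i, snd (ys k) $ i) \<in> D i" using ysC[of k] by (simp add: C_def)
        fix z1 z2 assume "(z1, z2) \<in> D i"
        thus "dist (fst (F (xs k)) $ i, snd (F (xs k)) $ i) (fst (ys k) $ i, snd (ys k) $ i)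
            \<le> dist (fst (F (xs k)) $ i, snd (F (xs k)) $ i) (z1, z2)"
          using ysC[of k] near[of _ k] by (intro nearest_point_componentwise[where D = D]) (auto simp: C_def)
      qed
      from N(2)[OF less_imp_le[OF cs[of k]] this] show ?case by (simp add: \<mu>s_def)
    qed
  qed
  hence "\<forall>\<^sub>F k in sequentially. \<forall>i. (fst (\<mu>s k) $ i, snd (\<mu>s k) $ i) \<in> N i"
    by (rule eventually_all_finite)
  then obtain n where n: "\<forall>k\<ge>n. \<forall>i. (fst (\<mu>s k) $ i, snd (\<mu>s k) $ i) \<in> N i"
    by (auto simp: eventually_sequentially)
  define K where "K = {\<mu>. \<forall>i. (fst \<mu> $ i, snd \<mu> $ i) \<in> N i}"
  have xn: "(\<lambda>k. xs (k + n)) \<longlonglongrightarrow> a" using xs by (rule LIMSEQ_ignore_initial_segment)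
  have "p \<in> multiplier_gradient G H a ` K"
  proof (rule limit_of_multipliers[where T = "\<lambda>k. multiplier_gradient G H (xs (k + n))"
        and A = "multiplier_gradient G H a" and K = K and \<eta>s = "\<lambda>k. \<mu>s (k + n)" and p = p])
    show "closed K" unfolding K_def by (rule closed_comp) (rule N)
    show "c *\<^sub>R z \<in> K" if "0 \<le> c" "z \<in> K" for c z
      using N(2)[OF that(1)] that(2) by (fastforce simp: K_def)
    show "z = 0" if "z \<in> K" "multiplier_gradient G H a z = 0" for z
      using cq that by (simp add: K_def)
    show "\<mu>s (k + n) \<in> K" for k using n by (simp add: K_def)
    show "(\<lambda>k. multiplier_gradient G H (xs (k + n)) (\<mu>s (k + n))) \<longlonglongrightarrow> p"
      using LIMSEQ_ignore_initial_segment[OF lim, of n] by (simp add: adj \<mu>s_def)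
    show "(\<lambda>k. multiplier_gradient G H (xs (r k + n)) (zs k)) \<longlonglongrightarrow> multiplier_gradient G H a z"
      if "strict_mono r" "zs \<longlonglongrightarrow> z" for r zs z
      using LIMSEQ_subseq_LIMSEQ[OF xn that(1)] that(2)
      by (intro tendsto_multiplier_gradient G H) (simp_all add: o_def)
  qed (use linear_multiplier_gradient in auto)
  with p show ?thesis unfolding K_def by blast
qed

section \<open>Multipliers for complementarity constraints\<close>

lemma half_line_projection:
  fixes b y :: real
  assumes "0 \<le> y" "\<And>y'. 0 \<le> y' \<Longrightarrow> \<bar>b - y\<bar> \<le> \<bar>b - y'\<bar>"
  shows "b \<le> y \<and> (0 < y \<longrightarrow> b = y)"
proof (cases "0 \<le> b")
  case True
  thus ?thesis using assms(2)[of b] by simp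
next
  case False
  thus ?thesis using assms(1) assms(2)[of 0] by simp
qed

lemma dist_Pair_le_iff:
  fixes b1 b2 y z :: real
  shows "dist (b1, b2) (y, z) \<le> dist (b1, b2) (y', z) \<longleftrightarrow> \<bar>b1 - y\<bar> \<le> \<bar>b1 - y'\<bar>"
    and "dist (b1, b2) (y, z) \<le> dist (b1, b2) (y, z') \<longleftrightarrow> \<bar>b2 - z\<bar> \<le> \<bar>b2 - z'\<bar>"
  by (simp_all add: dist_Pair_Pair dist_real_def abs_le_square_iff)

lemma mem_feasible_set_iff:
  "x \<in> feasible_set G H \<longleftrightarrow> (\<forall>i. 0 \<le> G x $ i \<and> 0 \<le> H x $ i \<and> G x $ i * H x $ i = 0)"
proof -
  have "G x \<bullet> H x = 0 \<longleftrightarrow> (\<forall>i. G x $ i * H x $ i = 0)"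
    if "\<forall>i. 0 \<le> G x $ i" "\<forall>i. 0 \<le> H x $ i"
    using that by (simp add: inner_vec_def sum_nonneg_eq_0_iff)
  thus ?thesis by (auto simp: feasible_set_def)
qed

text \<open>
  All the multiplier systems for the complementarity constraints vanish at inactive constraints and
  differ only in the condition P on the pair \<open>(u\<^sub>i, v\<^sub>i)\<close> at biactive indices. Stated by components
  rather than by index sets, the conditions pass to limits and to exchanged G and H directly.
\<close>
definition mpcc_multiplier ::
  "(real \<Rightarrow> real \<Rightarrow> bool) \<Rightarrow> (real^'n \<Rightarrow> real^'m) \<Rightarrow> (real^'n \<Rightarrow> real^'m) \<Rightarrow> real^'n \<Rightarrow>
    real^'m \<Rightarrow> real^'m \<Rightarrow> bool" where
  "mpcc_multiplier P G H x u v \<longleftrightarrow>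
     (\<forall>i. (G x $ i \<noteq> 0 \<longrightarrow> u $ i = 0) \<and> (H x $ i \<noteq> 0 \<longrightarrow> v $ i = 0) \<and>
          (G x $ i = 0 \<and> H x $ i = 0 \<longrightarrow> P (u $ i) (v $ i)))"

lemma mpcc_multiplier_mono:
  assumes "mpcc_multiplier P G H x u v" "\<And>s t. P s t \<Longrightarrow> Q s t"
  shows "mpcc_multiplier Q G H x u v"
  using assms unfolding mpcc_multiplier_def by blast

lemma mpcc_multiplier_iff_index_sets:
  assumes "x \<in> feasible_set G H"
  shows "mpcc_multiplier P G H x u v \<longleftrightarrow>
    (\<forall>i\<in>I_p0 G H x. u $ i = 0) \<and> (\<forall>i\<in>I_0p G H x. v $ i = 0) \<and> (\<forall>i\<in>I_00 G H x. P (u $ i) (v $ i))"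
proof -
  have "i \<in> zero_indices G x \<or> i \<in> zero_indices H x" for i
    using assms by (auto simp: mem_feasible_set_iff zero_indices_def)
  thus ?thesis
    unfolding mpcc_multiplier_def I_p0_def I_0p_def I_00_def
    by (auto simp: zero_indices_def)
qed

abbreviation M_sign :: "real \<Rightarrow> real \<Rightarrow> bool" where
  "M_sign s t \<equiv> (0 < s \<and> 0 < t) \<or> s * t = 0"

text \<open>
  LICQ concerns a set of gradients together with the injectivity of their indexing; the coefficients
  u and v are carried over to that set along the inverse of the indexing.
\<close>
lemma MPCC_LICQ_unique:
  assumes licq: "MPCC_LICQ G H x"
    and \<mu>: "mpcc_multiplier (\<lambda>_ _. True) G H x u v" "multiplier_gradient G H x (u, v) = 0"
  shows "u = 0 \<and> v = 0"
proof -
  define J where "J = zero_indices G x <+> zero_indices H x"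
  define g where "g = case_sum (\<lambda>i. column i (nabla G x)) (\<lambda>i. column i (nabla H x))"
  define c where "c = case_sum (($) u) (($) v)"
  have inj: "inj_on g J" and ind: "independent (g ` J)"
    using licq by (auto simp: MPCC_LICQ_def J_def g_def Let_def)
  have "(\<Sum>j\<in>J. c j *\<^sub>R g j) = (\<Sum>i\<in>zero_indices G x. u $ i *\<^sub>R column i (nabla G x))
      + (\<Sum>i\<in>zero_indices H x. v $ i *\<^sub>R column i (nabla H x))"
    unfolding J_def by (subst sum.Plus) (auto simp: c_def g_def)
  also have "(\<Sum>i\<in>zero_indices G x. u $ i *\<^sub>R column i (nabla G x)) = nabla G x *v u"
    using \<mu>(1) unfolding matrix_mult_sum scalar_mult_eq_scaleR
    by (intro sum.mono_neutral_left) (auto simp: mpcc_multiplier_def zero_indices_def)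
  also have "(\<Sum>i\<in>zero_indices H x. v $ i *\<^sub>R column i (nabla H x)) = nabla H x *v v"
    using \<mu>(1) unfolding matrix_mult_sum scalar_mult_eq_scaleR
    by (intro sum.mono_neutral_left) (auto simp: mpcc_multiplier_def zero_indices_def)
  finally have "(\<Sum>j\<in>J. c j *\<^sub>R g j) = 0"
    using \<mu>(2) by (simp add: multiplier_gradient_def)
  hence "(\<Sum>y\<in>g ` J. c (the_inv_into J g y) *\<^sub>R y) = 0"
    using inj by (simp add: sum.reindex the_inv_into_f_f)
  hence "c (the_inv_into J g y) = 0" if "y \<in> g ` J" for y
    using independentD[OF ind _ order_refl, of "\<lambda>y. c (the_inv_into J g y)" y] that
    by (auto simp: J_def)
  hence c0: "c j = 0" if "j \<in> J" for j
    using that inj by (metis image_eqI the_inv_into_f_f)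
  have "u $ i = 0" for i
    using c0[of "Inl i"] \<mu>(1) by (auto simp: J_def c_def zero_indices_def mpcc_multiplier_def)
  moreover have "v $ i = 0" for i
    using c0[of "Inr i"] \<mu>(1) by (auto simp: J_def c_def zero_indices_def mpcc_multiplier_def)
  ultimately show ?thesis by (simp add: vec_eq_iff)
qed

lemma MPCC_LICQ_imp_NNAMCQ:
  assumes x: "x \<in> feasible_set G H" and licq: "MPCC_LICQ G H x"
  shows "MPCC_NNAMCQ G H x"
proof -
  have "u = 0 \<and> v = 0"
    if "0 = nabla G x *v u + nabla H x *v v" "\<forall>i\<in>I_p0 G H x. u $ i = 0" "\<forall>i\<in>I_0p G H x. v $ i = 0" for u v
  proof (rule MPCC_LICQ_unique[OF licq])
    show "mpcc_multiplier (\<lambda>_ _. True) G H x u v"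
      using that by (simp add: mpcc_multiplier_iff_index_sets[OF x])
    show "multiplier_gradient G H x (u, v) = 0" using that by (simp add: multiplier_gradient_def)
  qed
  thus ?thesis unfolding MPCC_NNAMCQ_def by blast
qed

lemma MPCC_swap:
  fixes G H :: "real^'n \<Rightarrow> real^'m"
  shows "feasible_set H G = feasible_set G H" "MPCC_LICQ H G x \<longleftrightarrow> MPCC_LICQ G H x"
proof -
  show "feasible_set H G = feasible_set G H"
    by (auto simp: feasible_set_def inner_commute)
  have *: "MPCC_LICQ H G x" if "MPCC_LICQ G H x" for G H :: "real^'n \<Rightarrow> real^'m"
  proof -
    let ?J = "zero_indices G x <+> zero_indices H x" and ?J' = "zero_indices H x <+> zero_indices G x"
    let ?g = "case_sum (\<lambda>i. column i (nabla G x)) (\<lambda>i. column i (nabla H x))"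
    let ?g' = "case_sum (\<lambda>i. column i (nabla H x)) (\<lambda>i. column i (nabla G x))"
    let ?sw = "case_sum Inr Inl :: 'm + 'm \<Rightarrow> 'm + 'm"
    have J: "?sw ` ?J' = ?J" by (simp add: Plus_def image_Un image_image Un_commute)
    have g: "?g' = ?g \<circ> ?sw" by (rule ext) (simp split: sum.split)
    have "inj_on ?sw ?J'" by (auto simp: inj_on_def split: sum.splits)
    moreover have "inj_on ?g ?J" "independent (?g ` ?J)" using that by (auto simp: MPCC_LICQ_def Let_def)
    ultimately have "inj_on (?g \<circ> ?sw) ?J' \<and> independent ((?g \<circ> ?sw) ` ?J')"
      unfolding image_comp[symmetric] J by (intro conjI comp_inj_on) (simp_all add: J)
    thus ?thesis unfolding MPCC_LICQ_def Let_def g .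
  qed
  show "MPCC_LICQ H G x \<longleftrightarrow> MPCC_LICQ G H x"
    using *[of G H] *[of H G] by blast
qed

text \<open>
  This is how an inactive constraint forces its multiplier to vanish: nearest points
  close to the base point still have a positive coordinate, and there the constraint set is locally a line.
\<close>
lemma positive_coordinates_persist:
  fixes g h :: real
  assumes "0 \<le> g" "0 \<le> h"
  shows "\<exists>\<delta>>0. \<forall>q\<in>ball (g, h) \<delta>. (g \<noteq> 0 \<longrightarrow> 0 < fst q) \<and> (h \<noteq> 0 \<longrightarrow> 0 < snd q)"
proof (intro exI conjI ballI)
  let ?\<delta> = "min (if g = 0 then 1 else g) (if h = 0 then 1 else h)"
  show "0 < ?\<delta>" using assms by simp
  fix q assume "q \<in> ball (g, h) ?\<delta>"
  moreover have "\<bar>g - fst q\<bar> \<le> dist (g, h) q" "\<bar>h - snd q\<bar> \<le> dist (g, h) q"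
    using dist_fst_le[of "(g, h)" q] dist_snd_le[of "(g, h)" q] by (simp_all add: dist_real_def)
  ultimately show "g \<noteq> 0 \<longrightarrow> 0 < fst q" "h \<noteq> 0 \<longrightarrow> 0 < snd q" by auto
qed

text \<open>
  The nearest point q of \<open>D = {(y, z). y \<ge> 0, z \<ge> 0, y z = 0}\<close> to a point b either lies in the interior of
  a half-axis, where \<open>q - b\<close> is orthogonal to that axis and one multiplier vanishes, or it is the
  origin, where b has no positive coordinate and both multipliers are nonnegative.
\<close>
lemma M_multipliers:
  fixes G H :: "real^'n \<Rightarrow> real^'m"
  assumes G: "continuously_differentiable G" and H: "continuously_differentiable H"
    and a: "a \<in> feasible_set G H" and cq: "MPCC_NNAMCQ G H a"
    and conv: "convex_on UNIV \<psi>" and min: "local_minimizer \<psi> (feasible_set G H) a"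
  shows "\<exists>u v. multiplier_gradient G H a (u, v) \<in> convex_subdifferential \<psi> a \<and> mpcc_multiplier M_sign G H a u v"
proof -
  define D :: "(real \<times> real) set" where "D = {(y, z). 0 \<le> y \<and> 0 \<le> z \<and> y * z = 0}"
  (* The M-conditions with weak inequalities, an equivalent form that is visibly closed. *)
  define N :: "'m \<Rightarrow> (real \<times> real) set" where
    "N i = {(s, t). (G a $ i \<noteq> 0 \<longrightarrow> s = 0) \<and> (H a $ i \<noteq> 0 \<longrightarrow> t = 0) \<and>
                    ((0 \<le> s \<and> 0 \<le> t) \<or> s * t = 0)}" for i
  have feas: "x \<in> feasible_set G H \<longleftrightarrow> (\<forall>i. (G x $ i, H x $ i) \<in> D)" for x
    by (simp add: mem_feasible_set_iff D_def)
  have N_iff: "(\<forall>i. (u $ i, v $ i) \<in> N i) \<longleftrightarrow> mpcc_multiplier M_sign G H a u v" for u v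
  proof -
    have "G a $ i = 0 \<or> H a $ i = 0" for i using a by (simp add: mem_feasible_set_iff)
    thus ?thesis unfolding N_def mpcc_multiplier_def by (fastforce simp: order_less_le)
  qed
  obtain e where e: "e > 0" and min': "\<forall>x\<in>feasible_set G H \<inter> ball a e. \<psi> a \<le> \<psi> x"
    using min by (auto simp: local_minimizer_def)
  have normal: "q - b \<in> N i"
    if q: "q \<in> D" and pos: "G a $ i \<noteq> 0 \<longrightarrow> 0 < fst q" "H a $ i \<noteq> 0 \<longrightarrow> 0 < snd q"
      and near: "\<forall>q'\<in>D. dist b q \<le> dist b q'" for q b i
  proof -
    obtain y z b1 b2 where yz: "q = (y, z)" "b = (b1, b2)" by (cases q, cases b)
    have D: "0 \<le> y" "0 \<le> z" "y * z = 0" using q by (auto simp: D_def yz)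
    have y: "b1 \<le> y \<and> (0 < y \<longrightarrow> b1 = y)" if "z = 0"
    proof (rule half_line_projection[OF D(1)])
      fix y' :: real assume "0 \<le> y'"
      hence "(y', z) \<in> D" using that by (simp add: D_def)
      from bspec[OF near this] show "\<bar>b1 - y\<bar> \<le> \<bar>b1 - y'\<bar>" by (simp add: yz dist_Pair_le_iff)
    qed
    have z: "b2 \<le> z \<and> (0 < z \<longrightarrow> b2 = z)" if "y = 0"
    proof (rule half_line_projection[OF D(2)])
      fix z' :: real assume "0 \<le> z'"
      hence "(y, z') \<in> D" using that by (simp add: D_def)
      from bspec[OF near this] show "\<bar>b2 - z\<bar> \<le> \<bar>b2 - z'\<bar>" by (simp add: yz dist_Pair_le_iff)
    qed
    have "G a $ i = 0 \<or> H a $ i = 0" using a by (simp add: mem_feasible_set_iff)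
    thus ?thesis using D y z pos unfolding N_def yz by (cases "y = 0"; cases "z = 0") auto
  qed
  have "\<exists>\<mu>. multiplier_gradient G H a \<mu> \<in> convex_subdifferential \<psi> a \<and> (\<forall>i. (fst \<mu> $ i, snd \<mu> $ i) \<in> N i)"
  proof (rule componentwise_constraint_multipliers[OF G H conv _ _ _ _ _ _ e])
    show "closed D"
      unfolding D_def case_prod_beta by (intro closed_Collect_conj closed_Collect_le closed_Collect_eq continuous_intros)
    show "(G a $ i, H a $ i) \<in> D" for i using a feas by simp
    show "closed (N i)" for i
      unfolding N_def case_prod_beta
      by (intro closed_Collect_conj closed_Collect_imp closed_Collect_disj open_Collect_const closed_Collect_le closed_Collect_eq continuous_intros)
    show "c *\<^sub>R z \<in> N i" if "0 \<le> c" "z \<in> N i" for c z i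
      using that by (cases z) (auto simp: N_def)
    show "\<exists>\<delta>>0. \<forall>q\<in>D \<inter> ball (G a $ i, H a $ i) \<delta>. \<forall>b. (\<forall>q'\<in>D. dist b q \<le> dist b q') \<longrightarrow> q - b \<in> N i" for i
    proof -
      have "0 \<le> G a $ i" "0 \<le> H a $ i" using a by (simp_all add: mem_feasible_set_iff)
      from positive_coordinates_persist[OF this] show ?thesis using normal[of _ i] by blast
    qed
    show "\<mu> = 0" if "\<forall>i. (fst \<mu> $ i, snd \<mu> $ i) \<in> N i" "multiplier_gradient G H a \<mu> = 0" for \<mu>
    proof -
      have "mpcc_multiplier M_sign G H a (fst \<mu>) (snd \<mu>)" using that N_iff by blast
      hence "(fst \<mu>, snd \<mu>) = (0, 0)"
        using cq that(2) unfolding mpcc_multiplier_iff_index_sets[OF a] MPCC_NNAMCQ_def multiplier_gradient_def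
        by metis
      thus ?thesis by (simp add: prod_eq_iff)
    qed
    show "\<forall>x\<in>ball a e. (\<forall>i. (G x $ i, H x $ i) \<in> D) \<longrightarrow> \<psi> a \<le> \<psi> x"
      using min' feas by blast
  qed
  then obtain \<mu> where "multiplier_gradient G H a \<mu> \<in> convex_subdifferential \<psi> a" "\<forall>i. (fst \<mu> $ i, snd \<mu> $ i) \<in> N i"
    by blast
  thus ?thesis using N_iff by (intro exI[of _ "fst \<mu>"] exI[of _ "snd \<mu>"]) simp
qed

text \<open>
  The half-axes in the definition of \<open>D\<close> are those compatible with the base point, and at biactive
  indices the one with \<open>G\<^sub>i = 0\<close>. The set they define is contained in the feasible set, so \<open>a\<close> remains
  a minimizer, and there the sign of v is controlled while u is free at biactive indices.
  Exchanging G and H gives the other branch.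
\<close>
lemma branch_multipliers:
  fixes G H :: "real^'n \<Rightarrow> real^'m"
  assumes G: "continuously_differentiable G" and H: "continuously_differentiable H"
    and a: "a \<in> feasible_set G H" and licq: "MPCC_LICQ G H a"
    and conv: "convex_on UNIV \<psi>" and min: "local_minimizer \<psi> (feasible_set G H) a"
  shows "\<exists>u v. multiplier_gradient G H a (u, v) \<in> convex_subdifferential \<psi> a \<and>
    mpcc_multiplier (\<lambda>s t. 0 \<le> t) G H a u v"
proof -
  define D :: "'m \<Rightarrow> (real \<times> real) set" where
    "D i = (if G a $ i = 0 then {0} \<times> {0..} else {0..} \<times> {0})" for i
  define N :: "'m \<Rightarrow> (real \<times> real) set" where
    "N i = {(s, t). (G a $ i \<noteq> 0 \<longrightarrow> s = 0) \<and> (H a $ i \<noteq> 0 \<longrightarrow> t = 0) \<and> (G a $ i = 0 \<and> H a $ i = 0 \<longrightarrow> 0 \<le> t)}" for i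
  have feas: "x \<in> feasible_set G H" if "\<forall>i. (G x $ i, H x $ i) \<in> D i" for x
    unfolding mem_feasible_set_iff
  proof
    fix i show "0 \<le> G x $ i \<and> 0 \<le> H x $ i \<and> G x $ i * H x $ i = 0"
      using that[rule_format, of i] by (auto simp: D_def split: if_splits)
  qed
  have N_iff: "(\<forall>i. (u $ i, v $ i) \<in> N i) \<longleftrightarrow> mpcc_multiplier (\<lambda>s t. 0 \<le> t) G H a u v" for u v
    by (simp add: N_def mpcc_multiplier_def)
  obtain e where e: "e > 0" and min': "\<forall>x\<in>feasible_set G H \<inter> ball a e. \<psi> a \<le> \<psi> x"
    using min by (auto simp: local_minimizer_def)
  have normal: "q - b \<in> N i"
    if q: "q \<in> D i" and pos: "G a $ i \<noteq> 0 \<longrightarrow> 0 < fst q" "H a $ i \<noteq> 0 \<longrightarrow> 0 < snd q"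
      and near: "\<forall>q'\<in>D i. dist b q \<le> dist b q'" for q b i
  proof -
    obtain y z b1 b2 where yz: "q = (y, z)" "b = (b1, b2)" by (cases q, cases b)
    have comp: "G a $ i = 0 \<or> H a $ i = 0" using a by (simp add: mem_feasible_set_iff)
    show ?thesis
    proof (cases "G a $ i = 0")
      case True
      have "b2 \<le> z \<and> (0 < z \<longrightarrow> b2 = z)"
      proof (rule half_line_projection)
        show "0 \<le> z" using q(1) True by (simp add: D_def yz)
        fix z' :: real assume "0 \<le> z'"
        hence "(y, z') \<in> D i" using q(1) True by (simp add: D_def yz)
        from bspec[OF near this] show "\<bar>b2 - z\<bar> \<le> \<bar>b2 - z'\<bar>" by (simp add: yz dist_Pair_le_iff)
      qed
      thus ?thesis using pos True by (auto simp: N_def yz)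
    next
      case False
      have "b1 \<le> y \<and> (0 < y \<longrightarrow> b1 = y)"
      proof (rule half_line_projection)
        show "0 \<le> y" using q(1) False by (simp add: D_def yz)
        fix y' :: real assume "0 \<le> y'"
        hence "(y', z) \<in> D i" using q(1) False by (simp add: D_def yz)
        from bspec[OF near this] show "\<bar>b1 - y\<bar> \<le> \<bar>b1 - y'\<bar>" by (simp add: yz dist_Pair_le_iff)
      qed
      thus ?thesis using pos False comp by (auto simp: N_def yz)
    qed
  qed
  have "\<exists>\<mu>. multiplier_gradient G H a \<mu> \<in> convex_subdifferential \<psi> a \<and> (\<forall>i. (fst \<mu> $ i, snd \<mu> $ i) \<in> N i)"
  proof (rule componentwise_constraint_multipliers[OF G H conv _ _ _ _ _ _ e])
    show "closed (D i)" for i by (simp add: D_def closed_Times)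
    show "(G a $ i, H a $ i) \<in> D i" for i using a by (auto simp: D_def mem_feasible_set_iff)
    show "closed (N i)" for i
      unfolding N_def case_prod_beta
      by (intro closed_Collect_conj closed_Collect_imp open_Collect_const closed_Collect_le closed_Collect_eq continuous_intros)
    show "c *\<^sub>R z \<in> N i" if "0 \<le> c" "z \<in> N i" for c z i
      using that by (cases z) (auto simp: N_def)
    show "\<exists>\<delta>>0. \<forall>q\<in>D i \<inter> ball (G a $ i, H a $ i) \<delta>. \<forall>b. (\<forall>q'\<in>D i. dist b q \<le> dist b q') \<longrightarrow> q - b \<in> N i" for i
    proof -
      have "0 \<le> G a $ i" "0 \<le> H a $ i" using a by (simp_all add: mem_feasible_set_iff)
      from positive_coordinates_persist[OF this] show ?thesis using normal[of _ i] by blast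
    qed
    show "\<mu> = 0" if "\<forall>i. (fst \<mu> $ i, snd \<mu> $ i) \<in> N i" "multiplier_gradient G H a \<mu> = 0" for \<mu>
    proof -
      have "mpcc_multiplier (\<lambda>_ _. True) G H a (fst \<mu>) (snd \<mu>)"
        using that(1) unfolding N_iff by (simp add: mpcc_multiplier_def)
      from MPCC_LICQ_unique[OF licq this] that(2) show ?thesis by (simp add: prod_eq_iff)
    qed
    show "\<forall>x\<in>ball a e. (\<forall>i. (G x $ i, H x $ i) \<in> D i) \<longrightarrow> \<psi> a \<le> \<psi> x"
      using min' feas by blast
  qed
  then obtain \<mu> where "multiplier_gradient G H a \<mu> \<in> convex_subdifferential \<psi> a" "\<forall>i. (fst \<mu> $ i, snd \<mu> $ i) \<in> N i"
    by blast
  thus ?thesis using N_iff by (intro exI[of _ "fst \<mu>"] exI[of _ "snd \<mu>"]) simp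
qed

section \<open>Regular and limiting normals to the feasible set\<close>

lemma convex_on_inner_left: "convex_on UNIV (\<lambda>x :: 'a::real_inner. c \<bullet> x)"
  by (simp add: convex_on_def inner_add_right)

text \<open>
  The o-term of a regular normal cone need not be smooth or convex; locally it is dominated by the
  convex function \<open>\<epsilon> \<cdot> dist a\<close>, at the cost of an arbitrarily small \<open>\<epsilon>\<close>.
\<close>
lemma regular_normal_local_minimizer:
  assumes w: "w \<in> regular_normal_cone S a" and a: "a \<in> S" and \<epsilon>: "0 < \<epsilon>"
  shows "local_minimizer (\<lambda>x. - w \<bullet> x + \<epsilon> * dist a x) S a"
proof -
  obtain r where r: "r \<in> o[at a within S](\<lambda>x. norm (x - a))" "\<forall>x\<in>S. w \<bullet> (x - a) \<le> r x"
    using w by (auto simp: regular_normal_cone_def)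
  have "\<forall>\<^sub>F x in at a within S. norm (r x) \<le> \<epsilon> * norm (norm (x - a))"
    using landau_o.smallD[OF r(1) \<epsilon>] .
  then obtain d where d: "d > 0" "\<forall>x\<in>S. x \<noteq> a \<and> dist x a < d \<longrightarrow> norm (r x) \<le> \<epsilon> * norm (norm (x - a))"
    unfolding eventually_at by blast
  have "- w \<bullet> a + \<epsilon> * dist a a \<le> - w \<bullet> x + \<epsilon> * dist a x" if x: "x \<in> S \<inter> ball a d" for x
  proof (cases "x = a")
    case False
    have "w \<bullet> (x - a) \<le> r x" using r(2) x by blast
    also have "r x \<le> \<epsilon> * norm (x - a)"
      using d(2)[rule_format, of x] x False by (auto simp: dist_commute)
    finally show ?thesis by (simp add: inner_diff_right dist_norm norm_minus_commute)
  qed simp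
  with d(1) a show ?thesis unfolding local_minimizer_def by blast
qed

lemma convex_subdifferential_norm_perturbation:
  assumes p: "p \<in> convex_subdifferential (\<lambda>x. c \<bullet> x + \<epsilon> * dist a x) a"
    and \<epsilon>: "0 \<le> \<epsilon>"
  shows "norm (p - c) \<le> \<epsilon>"
proof -
  have "c \<bullet> a + p \<bullet> (p - c) \<le> c \<bullet> (a + (p - c)) + \<epsilon> * norm (p - c)"
    using p by (auto simp: convex_subdifferential_def dist_norm norm_minus_commute dest!: spec[of _ "a + (p - c)"])
  hence "(p - c) \<bullet> (p - c) \<le> \<epsilon> * norm (p - c)"
    by (simp add: inner_add_right inner_diff_left)
  hence "norm (p - c) * norm (p - c) \<le> \<epsilon> * norm (p - c)"
    by (simp add: dot_square_norm power2_eq_square)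
  thus ?thesis using \<epsilon> by (cases "p = c") auto
qed

text \<open>
  The branch multipliers for the perturbed objectives represent points within \<open>\<epsilon>\<close> of \<open>- w\<close>; LICQ gives
  the limit \<open>\<epsilon> \<rightarrow> 0\<close> by \<open>limit_of_multipliers\<close>, here with a fixed linear map.
\<close>
lemma regular_normal_branch_multipliers:
  fixes G H :: "real^'n \<Rightarrow> real^'m"
  assumes G: "continuously_differentiable G" and H: "continuously_differentiable H"
    and a: "a \<in> feasible_set G H" and licq: "MPCC_LICQ G H a"
    and w: "w \<in> regular_normal_cone (feasible_set G H) a"
  shows "\<exists>u v. - w = multiplier_gradient G H a (u, v) \<and> mpcc_multiplier (\<lambda>s t. 0 \<le> t) G H a u v"
proof -
  define K where "K = {\<mu>. mpcc_multiplier (\<lambda>s t. 0 \<le> t) G H a (fst \<mu>) (snd \<mu>)}"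
  have "\<exists>\<mu>\<in>K. norm (multiplier_gradient G H a \<mu> - - w) \<le> 1 / real (Suc k)" for k
  proof -
    define \<psi> where "\<psi> x = - w \<bullet> x + 1 / real (Suc k) * dist a x" for x
    have "convex_on UNIV \<psi>"
      unfolding \<psi>_def by (intro convex_on_add convex_on_inner_left convex_on_cmul convex_on_dist) auto
    moreover have "local_minimizer \<psi> (feasible_set G H) a"
      unfolding \<psi>_def by (rule regular_normal_local_minimizer[OF w a]) simp
    ultimately obtain u v where uv: "multiplier_gradient G H a (u, v) \<in> convex_subdifferential \<psi> a"
      "mpcc_multiplier (\<lambda>s t. 0 \<le> t) G H a u v"
      using branch_multipliers[OF G H a licq] by blast
    from convex_subdifferential_norm_perturbation[OF uv(1)[unfolded \<psi>_def]]
    have "norm (multiplier_gradient G H a (u, v) - - w) \<le> 1 / real (Suc k)" by simp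
    thus ?thesis using uv(2) by (intro bexI[of _ "(u, v)"]) (auto simp: K_def)
  qed
  then obtain \<mu>s where \<mu>s: "\<And>k. \<mu>s k \<in> K" 
    "\<And>k. norm (multiplier_gradient G H a (\<mu>s k) - - w) \<le> 1 / real (Suc k)" by metis
  have "(\<lambda>k. multiplier_gradient G H a (\<mu>s k) - - w) \<longlonglongrightarrow> 0"
    by (rule Lim_null_comparison[OF _ LIMSEQ_Suc[OF lim_1_over_n]]) (use \<mu>s(2) in simp)
  hence lim: "(\<lambda>k. multiplier_gradient G H a (\<mu>s k)) \<longlonglongrightarrow> - w" by (simp only: LIM_zero_iff)
  have "- w \<in> multiplier_gradient G H a ` K"
  proof (rule limit_of_multipliers[where T = "\<lambda>_. multiplier_gradient G H a" and K = K and \<eta>s = \<mu>s])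
    show "closed K" unfolding K_def mpcc_multiplier_def
      by (intro closed_Collect_all closed_Collect_conj closed_Collect_imp open_Collect_const
          closed_Collect_le closed_Collect_eq continuous_intros)
    show "c *\<^sub>R z \<in> K" if "0 \<le> c" "z \<in> K" for c z
      using that by (auto simp: K_def mpcc_multiplier_def)
    show "z = 0" if "z \<in> K" "multiplier_gradient G H a z = 0" for z
    proof -
      have "mpcc_multiplier (\<lambda>_ _. True) G H a (fst z) (snd z)"
        using that(1) by (simp add: K_def mpcc_multiplier_def)
      from MPCC_LICQ_unique[OF licq this] that(2) show ?thesis by (simp add: prod_eq_iff)
    qed
    show "(\<lambda>k. multiplier_gradient G H a (zs k)) \<longlonglongrightarrow> multiplier_gradient G H a z" if "zs \<longlonglongrightarrow> z" for zs z
      by (rule tendsto_multiplier_gradient[OF G H tendsto_const that])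
  qed (use \<mu>s lim linear_multiplier_gradient in auto)
  thus ?thesis by (force simp: K_def)
qed

lemma regular_normal_S_multipliers:
  fixes G H :: "real^'n \<Rightarrow> real^'m"
  assumes G: "continuously_differentiable G" and H: "continuously_differentiable H"
    and a: "a \<in> feasible_set G H" and licq: "MPCC_LICQ G H a"
    and w: "w \<in> regular_normal_cone (feasible_set G H) a"
  shows "\<exists>u v. - w = multiplier_gradient G H a (u, v) \<and> mpcc_multiplier (\<lambda>s t. 0 \<le> s \<and> 0 \<le> t) G H a u v"
proof -
  obtain u v where uv: "- w = multiplier_gradient G H a (u, v)" "mpcc_multiplier (\<lambda>s t. 0 \<le> t) G H a u v"
    using regular_normal_branch_multipliers[OF G H a licq w] by blast
  obtain v' u' where uv': "- w = multiplier_gradient H G a (v', u')" "mpcc_multiplier (\<lambda>s t. 0 \<le> t) H G a v' u'"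
    using regular_normal_branch_multipliers[OF H G, of a w] a licq w by (auto simp: MPCC_swap)
  have "u - u' = 0 \<and> v - v' = 0"
  proof (rule MPCC_LICQ_unique[OF licq])
    show "mpcc_multiplier (\<lambda>_ _. True) G H a (u - u') (v - v')"
      using uv(2) uv'(2) by (simp add: mpcc_multiplier_def)
    have "multiplier_gradient G H a ((u, v) - (u', v')) = 0"
      using uv(1) uv'(1) linear_diff[OF linear_multiplier_gradient, of G H a "(u, v)" "(u', v')"]
      by (simp add: multiplier_gradient_swap)
    thus "multiplier_gradient G H a (u - u', v - v') = 0" by simp
  qed
  thus ?thesis using uv uv'(2) by (intro exI[of _ u] exI[of _ v]) (auto simp: mpcc_multiplier_def)
qed

text \<open>
  Expanding \<open>\<parallel>x - y\<parallel>\<^sup>2 \<le> \<parallel>x - z\<parallel>\<^sup>2\<close> bounds \<open>(x - y) \<bullet> (z - y)\<close> by a quadratic, hence o-small, term.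
\<close>
lemma proximal_normal_is_regular:
  assumes y: "y \<in> S" and near: "\<forall>z\<in>S. dist x y \<le> dist x z" and c: "0 \<le> c"
  shows "c *\<^sub>R (x - y) \<in> regular_normal_cone S y"
proof -
  define r where "r z = c / 2 * (norm (z - y))\<^sup>2" for z
  have "r \<in> o[at y within S](\<lambda>z. norm (z - y))"
  proof (rule smalloI_tendsto)
    have "((\<lambda>z. c / 2 * norm (z - y)) \<longlongrightarrow> c / 2 * norm (y - y)) (at y within S)"
      by (intro tendsto_intros)
    moreover have "(\<lambda>z. r z / norm (z - y)) = (\<lambda>z. c / 2 * norm (z - y))"
      by (auto simp: r_def power2_eq_square)
    ultimately show "((\<lambda>z. r z / norm (z - y)) \<longlongrightarrow> 0) (at y within S)" by simp
    show "\<forall>\<^sub>F z in at y within S. norm (z - y) \<noteq> 0"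
      by (auto simp: eventually_at_filter)
  qed
  moreover have "c *\<^sub>R (x - y) \<bullet> (z - y) \<le> r z" if "z \<in> S" for z
  proof -
    have "(norm (x - y))\<^sup>2 \<le> (norm (x - z))\<^sup>2"
      using near that by (intro power_mono) (auto simp: dist_norm)
    hence "2 * ((x - y) \<bullet> (z - y)) \<le> (norm (z - y))\<^sup>2"
      by (simp add: power2_norm_eq_inner inner_diff_left inner_diff_right inner_commute)
    from mult_left_mono[OF this, of "c / 2"] c show ?thesis by (simp add: r_def)
  qed
  ultimately show ?thesis by (auto simp: regular_normal_cone_def)
qed

text \<open>
  The optimality condition \<open>0 \<in> \<partial>\<psi>(a) + N(a)\<close>, obtained by penalizing the distance to S itself: the
  residuals \<open>x - y\<close> of nearest points y of S are proximal normals at y.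
\<close>
lemma minimizer_limiting_normal:
  fixes \<psi> :: "real^'n \<Rightarrow> real"
  assumes S: "closed S" and conv: "convex_on UNIV \<psi>" and min: "local_minimizer \<psi> S a"
  shows "\<exists>p\<in>convex_subdifferential \<psi> a. - p \<in> limiting_normal_cone S a"
proof -
  obtain e where e: "e > 0" and min': "\<forall>x\<in>ball a e. x \<in> S \<longrightarrow> \<psi> a \<le> \<psi> x" and a: "a \<in> S"
    using min by (auto simp: local_minimizer_def)
  have der: "((\<lambda>x. x) has_derivative (\<lambda>h. h)) (at x)" for x :: "real^'n" by (rule has_derivative_ident)
  have adj: "adjoint (\<lambda>h :: real^'n. h) = (\<lambda>h. h)" by (rule adjoint_unique) simp
  from penalty_multipliers[OF der conv S a e min']
  obtain p xs ys cs where p: "p \<in> convex_subdifferential \<psi> a" and ys: "ys \<longlonglongrightarrow> a"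
    and proj: "\<forall>k::nat. ys k \<in> S \<and> 0 < cs k \<and> (\<forall>z\<in>S. dist (xs k) (ys k) \<le> dist (xs k) z)"
    and lim: "(\<lambda>k. adjoint (\<lambda>h. h) (cs k *\<^sub>R (ys k - xs k))) \<longlonglongrightarrow> p"
    by (elim exE conjE) (rule that)
  have "cs k *\<^sub>R (xs k - ys k) \<in> regular_normal_cone S (ys k)" for k
    using proj by (intro proximal_normal_is_regular) (auto intro: less_imp_le)
  moreover have "(\<lambda>k. cs k *\<^sub>R (xs k - ys k)) \<longlonglongrightarrow> - p"
    using tendsto_minus[OF lim] by (simp add: adj algebra_simps)
  ultimately have "- p \<in> limiting_normal_cone S a"
    using ys proj unfolding limiting_normal_cone_def
    by (intro CollectI exI[of _ ys] exI[of _ "\<lambda>k. cs k *\<^sub>R (xs k - ys k)"]) simp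
  with p show ?thesis by blast
qed

lemma closed_feasible_set:
  assumes "continuously_differentiable G" "continuously_differentiable H"
  shows "closed (feasible_set G H)"
  unfolding feasible_set_def
  by (intro closed_Collect_conj closed_Collect_all closed_Collect_le closed_Collect_eq continuous_intros
      continuously_differentiable_imp_continuous_on assms)

section \<open>From local or convex subgradients to limiting ones\<close>

text \<open>
  The remainder can be taken as the negative part of \<open>\<phi> x - \<phi> a - p \<bullet> (x - a)\<close>, which vanishes near a
  but absorbs a failure of the inequality far away.
\<close>
lemma regular_subdifferentialI:
  assumes "\<forall>\<^sub>F x in nhds a. \<phi> a + p \<bullet> (x - a) \<le> \<phi> x"
  shows "p \<in> regular_subdifferential \<phi> a"
proof -
  define r where "r x = min 0 (\<phi> x - \<phi> a - p \<bullet> (x - a))" for x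
  have "\<forall>\<^sub>F x in at a. r x = 0"
    using assms unfolding eventually_at_filter by eventually_elim (simp add: r_def)
  hence "r \<in> o[at a](\<lambda>x. norm (x - a))"
    by (subst landau_o.small.in_cong) auto
  moreover have "\<phi> a + p \<bullet> (x - a) + r x \<le> \<phi> x" for x by (simp add: r_def)
  ultimately show ?thesis by (auto simp: regular_subdifferential_def)
qed

lemma convex_subdifferential_subset_limiting:
  "convex_subdifferential \<phi> a \<subseteq> limiting_subdifferential \<phi> a"
proof
  fix p assume "p \<in> convex_subdifferential \<phi> a"
  hence "p \<in> regular_subdifferential \<phi> a"
    by (intro regular_subdifferentialI) (simp add: convex_subdifferential_def)
  thus "p \<in> limiting_subdifferential \<phi> a"
    unfolding limiting_subdifferential_def
    by (intro CollectI exI[of _ "\<lambda>_. a"] exI[of _ "\<lambda>_. p"]) simp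
qed

section \<open>Convex pieces of the capped l1 function\<close>

definition scaled_l1 :: "real \<Rightarrow> real^'n \<Rightarrow> real" where
  "scaled_l1 \<nu> x = (\<Sum>i\<in>UNIV. \<bar>x $ i\<bar> / \<nu>)"

lemma convex_scaled_l1:
  assumes "\<nu> > 0"
  shows "convex_on UNIV (scaled_l1 \<nu>)"
  unfolding convex_on_def
proof (intro conjI ballI allI impI)
  fix x y :: "real^'n" and u v :: real
  assume uv: "0 \<le> u" "0 \<le> v"
  have "\<bar>(u *\<^sub>R x + v *\<^sub>R y) $ i\<bar> / \<nu> \<le> u * (\<bar>x $ i\<bar> / \<nu>) + v * (\<bar>y $ i\<bar> / \<nu>)" for i
  proof -
    have "\<bar>u * x $ i + v * y $ i\<bar> \<le> u * \<bar>x $ i\<bar> + v * \<bar>y $ i\<bar>"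
      using abs_triangle_ineq[of "u * x $ i" "v * y $ i"] uv by (simp add: abs_mult)
    thus ?thesis using assms by (simp add: field_simps)
  qed
  thus "scaled_l1 \<nu> (u *\<^sub>R x + v *\<^sub>R y) \<le> u * scaled_l1 \<nu> x + v * scaled_l1 \<nu> y"
    unfolding scaled_l1_def sum_distrib_left sum.distrib[symmetric] by (rule sum_mono)
qed simp

lemma scaled_l1_scaleR: "0 \<le> t \<Longrightarrow> scaled_l1 \<nu> (t *\<^sub>R x) = t * scaled_l1 \<nu> x"
  by (simp add: scaled_l1_def sum_distrib_left abs_mult)

text \<open>
  By positive homogeneity a subgradient at \<open>a\<close> is one along the whole open ray through \<open>a\<close>. This allows
  the approach to \<open>a\<close> along that ray in \<open>subgradient_of_inner_piece\<close>.
\<close>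
lemma convex_subdifferential_scaled_l1_scaleR:
  assumes q: "q \<in> convex_subdifferential (scaled_l1 \<nu>) a" and t: "0 < t"
  shows "q \<in> convex_subdifferential (scaled_l1 \<nu>) (t *\<^sub>R a)"
  unfolding convex_subdifferential_def
proof (intro CollectI allI)
  fix y
  have "scaled_l1 \<nu> a + q \<bullet> ((1 / t) *\<^sub>R y - a) \<le> scaled_l1 \<nu> ((1 / t) *\<^sub>R y)"
    using q unfolding convex_subdifferential_def by blast
  hence "t * (scaled_l1 \<nu> a + q \<bullet> ((1 / t) *\<^sub>R y - a)) \<le> t * scaled_l1 \<nu> ((1 / t) *\<^sub>R y)"
    using t by (intro mult_left_mono) auto
  thus "scaled_l1 \<nu> (t *\<^sub>R a) + q \<bullet> (y - t *\<^sub>R a) \<le> scaled_l1 \<nu> y"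
    using t by (simp add: scaled_l1_scaleR inner_diff_right algebra_simps)
qed

lemma convex_subdifferential_minus_inner:
  "p \<in> convex_subdifferential (\<lambda>x. \<phi> x - b \<bullet> x) a \<longleftrightarrow> p + b \<in> convex_subdifferential \<phi> a"
  by (simp add: convex_subdifferential_def inner_add_left inner_diff_right algebra_simps)

definition theta_slope :: "real \<Rightarrow> nat \<Rightarrow> real" where
  "theta_slope \<nu> k = (if k = 1 then 0 else if k = 2 then 1 / \<nu> else - 1 / \<nu>)"

lemma theta_affine: "theta \<nu> k t = theta_slope \<nu> k * t - (if k = 1 then 0 else 1)"
  by (simp add: theta_def theta_slope_def)

lemma deriv_theta: "deriv (theta \<nu> k) t = theta_slope \<nu> k"
proof (rule DERIV_imp_deriv)
  show "(theta \<nu> k has_real_derivative theta_slope \<nu> k) (at t)"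
    unfolding theta_affine[abs_def] by (auto intro!: derivative_eq_intros)
qed

lemma theta_majorant:
  assumes "\<nu> > 0"
  shows "min 1 (\<bar>t\<bar> / \<nu>) \<le> \<bar>t\<bar> / \<nu> - theta \<nu> k t"
proof -
  have "t / \<nu> \<le> \<bar>t\<bar> / \<nu>" "- (t / \<nu>) \<le> \<bar>t\<bar> / \<nu>"
    using assms divide_right_mono[of t "\<bar>t\<bar>" \<nu>] divide_right_mono[of "- t" "\<bar>t\<bar>" \<nu>] by auto
  thus ?thesis by (auto simp: theta_def)
qed

lemma theta_active:
  assumes \<nu>: "\<nu> > 0" and k: "k \<in> active_pieces \<nu> t"
  shows "min 1 (\<bar>t\<bar> / \<nu>) = \<bar>t\<bar> / \<nu> - theta \<nu> k t"
proof -
  have "\<bar>t\<bar> / \<nu> = \<bar>t / \<nu>\<bar>" using \<nu> by simp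
  moreover have "theta \<nu> k t = max 0 (max (t / \<nu> - 1) (- (t / \<nu>) - 1))"
    using k by (simp add: active_pieces_def theta_def)
  ultimately show ?thesis by (auto simp: min_def max_def abs_if)
qed

text \<open>
  The constant gradient of \<open>x \<mapsto> \<Sum>\<theta>\<^bsub>d i\<^esub>(x\<^sub>i)\<close>.
\<close>
definition piece_slopes :: "real \<Rightarrow> ('n \<Rightarrow> nat) \<Rightarrow> real^'n" where
  "piece_slopes \<nu> d = (\<chi> i. theta_slope \<nu> (d i))"

lemma sum_theta_affine:
  "(\<Sum>i\<in>UNIV. theta \<nu> (d i) (x $ i)) = piece_slopes \<nu> d \<bullet> x - (\<Sum>i\<in>UNIV. if d i = 1 then 0 else 1)"
  by (simp add: theta_affine sum_subtractf piece_slopes_def inner_vec_def)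

text \<open>
  Up to a constant, the function \<open>scaled_l1 \<nu> x - piece_slopes \<nu> d \<bullet> x\<close> majorizes \<open>\<Phi>\<close> everywhere and
  agrees with it at \<open>a\<close>, because each \<open>\<theta>\<^sub>k\<close> is bounded above by the maximum of the three and the chosen pieces attain it at \<open>a\<close>.
\<close>
lemma piece_majorant_local_minimizer:
  fixes a :: "real^'n"
  assumes \<nu>: "\<nu> > 0" and min: "local_minimizer (Phi \<nu>) S a"
    and d: "\<And>i. d i \<in> active_pieces \<nu> (a $ i)"
  shows "local_minimizer (\<lambda>x. scaled_l1 \<nu> x - piece_slopes \<nu> d \<bullet> x) S a"
proof -
  define c :: real where "c = (\<Sum>i\<in>UNIV. if d i = 1 then 0 else 1)"
  have le: "Phi \<nu> x \<le> scaled_l1 \<nu> x - piece_slopes \<nu> d \<bullet> x + c" for x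
  proof -
    have "Phi \<nu> x \<le> (\<Sum>i\<in>UNIV. \<bar>x $ i\<bar> / \<nu> - theta \<nu> (d i) (x $ i))"
      unfolding Phi_def by (intro sum_mono theta_majorant \<nu>)
    thus ?thesis by (simp add: sum_subtractf sum_theta_affine c_def scaled_l1_def)
  qed
  have eq: "Phi \<nu> a = scaled_l1 \<nu> a - piece_slopes \<nu> d \<bullet> a + c"
  proof -
    have "Phi \<nu> a = (\<Sum>i\<in>UNIV. \<bar>a $ i\<bar> / \<nu> - theta \<nu> (d i) (a $ i))"
      unfolding Phi_def by (intro sum.cong theta_active \<nu> d refl)
    thus ?thesis by (simp add: sum_subtractf sum_theta_affine c_def scaled_l1_def)
  qed
  have "scaled_l1 \<nu> a - piece_slopes \<nu> d \<bullet> a \<le> scaled_l1 \<nu> x - piece_slopes \<nu> d \<bullet> x"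
    if "Phi \<nu> a \<le> Phi \<nu> x" for x
    using le[of x] eq that by linarith
  thus ?thesis using min unfolding local_minimizer_def by blast
qed

text \<open>
  At a kink \<open>\<bar>t\<bar> = \<nu>\<close> two pieces are active; the choice \<open>\<theta>\<^sub>1\<close> is the one that remains active when t
  moves towards 0.
\<close>
definition inner_piece :: "real \<Rightarrow> real \<Rightarrow> nat" where
  "inner_piece \<nu> t = (if \<bar>t\<bar> \<le> \<nu> then 1 else if 0 < t then 2 else 3)"

lemma inner_piece_active:
  assumes "\<nu> > 0"
  shows "inner_piece \<nu> t \<in> active_pieces \<nu> t"
  using assms
  by (auto simp: active_pieces_def inner_piece_def theta_def max_def field_simps abs_if split: if_splits)

text \<open>
  Coordinates with \<open>\<bar>a\<^sub>i\<bar> = \<nu>\<close> are concave kinks of \<open>\<Phi>\<close>, where the regular subdifferential is empty; a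
  limit is unavoidable. Shrinking \<open>a\<close> slightly to \<open>t \<cdot> a\<close> with \<open>t < 1\<close> moves all these coordinates into the
  region \<open>\<bar>x\<^sub>i\<bar> < \<nu>\<close> and keeps \<open>\<bar>x\<^sub>i\<bar> > \<nu>\<close> where it holds at \<open>a\<close>, so near \<open>t \<cdot> a\<close> the function \<open>\<Phi>\<close> is, up to a
  constant, the convex piece selected by \<open>inner_piece\<close>, which has the subgradient p there as well.
\<close>
lemma subgradient_of_inner_piece:
  fixes a :: "real^'n"
  assumes \<nu>: "\<nu> > 0"
    and p: "p \<in> convex_subdifferential (\<lambda>x. scaled_l1 \<nu> x - piece_slopes \<nu> (\<lambda>i. inner_piece \<nu> (a $ i)) \<bullet> x) a"
  shows "p \<in> limiting_subdifferential (Phi \<nu>) a"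
proof -
  define d where "d i = inner_piece \<nu> (a $ i)" for i
  define b where "b = piece_slopes \<nu> d"
  define c :: real where "c = (\<Sum>i\<in>UNIV. if d i = 1 then 0 else 1)"
  have pb: "p + b \<in> convex_subdifferential (scaled_l1 \<nu>) a"
    using p by (simp add: convex_subdifferential_minus_inner b_def d_def[abs_def])
  define U where "U = {x :: real^'n. \<forall>i. if \<bar>a $ i\<bar> \<le> \<nu> then \<bar>x $ i\<bar> < \<nu> else \<nu> < sgn (a $ i) * x $ i}"
  have "open U"
  proof -
    have "open {x :: real^'n. if \<bar>a $ i\<bar> \<le> \<nu> then \<bar>x $ i\<bar> < \<nu> else \<nu> < sgn (a $ i) * x $ i}" for i
      by (cases "\<bar>a $ i\<bar> \<le> \<nu>") (simp_all, (intro open_Collect_less continuous_intros)+)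
    thus ?thesis unfolding U_def Collect_all_eq by (intro open_INT) auto
  qed
  have Phi_U: "Phi \<nu> x = scaled_l1 \<nu> x - b \<bullet> x + c" if "x \<in> U" for x
  proof -
    have "min 1 (\<bar>x $ i\<bar> / \<nu>) = \<bar>x $ i\<bar> / \<nu> - theta \<nu> (d i) (x $ i)" for i
    proof (rule theta_active[OF \<nu>])
      have "if \<bar>a $ i\<bar> \<le> \<nu> then \<bar>x $ i\<bar> < \<nu> else \<nu> < sgn (a $ i) * x $ i"
        using that unfolding U_def by blast
      hence "d i = inner_piece \<nu> (x $ i)"
        using \<nu> by (auto simp: d_def inner_piece_def sgn_if abs_if split: if_splits)
      thus "d i \<in> active_pieces \<nu> (x $ i)" using inner_piece_active[OF \<nu>] by simp
    qed
    hence "Phi \<nu> x = (\<Sum>i\<in>UNIV. \<bar>x $ i\<bar> / \<nu> - theta \<nu> (d i) (x $ i))"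
      by (simp add: Phi_def)
    thus ?thesis by (simp add: sum_subtractf sum_theta_affine c_def scaled_l1_def b_def)
  qed
  have sub: "p \<in> regular_subdifferential (Phi \<nu>) (t *\<^sub>R a)" if t: "0 < t" "t *\<^sub>R a \<in> U" for t
  proof (rule regular_subdifferentialI)
    have "\<forall>\<^sub>F x in nhds (t *\<^sub>R a). x \<in> U" using \<open>open U\<close> t(2) by (rule eventually_nhds_in_open)
    thus "\<forall>\<^sub>F x in nhds (t *\<^sub>R a). Phi \<nu> (t *\<^sub>R a) + p \<bullet> (x - t *\<^sub>R a) \<le> Phi \<nu> x"
    proof eventually_elim
      case (elim x)
      have "scaled_l1 \<nu> (t *\<^sub>R a) + (p + b) \<bullet> (x - t *\<^sub>R a) \<le> scaled_l1 \<nu> x"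
        using convex_subdifferential_scaled_l1_scaleR[OF pb t(1)] unfolding convex_subdifferential_def by blast
      thus ?case using Phi_U[OF elim] Phi_U[OF t(2)] by (simp add: inner_add_left inner_diff_right algebra_simps)
    qed
  qed
  (* t 0 = 0 is not admissible as a scaling factor; the final sequence starts at index Suc n. *)
  define t where "t k = real k / real (Suc k)" for k
  have tlim: "t \<longlonglongrightarrow> 1" unfolding t_def by (rule LIMSEQ_n_over_Suc_n)
  have "\<forall>\<^sub>F k in sequentially. if \<bar>a $ i\<bar> \<le> \<nu> then \<bar>(t k *\<^sub>R a) $ i\<bar> < \<nu> else \<nu> < sgn (a $ i) * (t k *\<^sub>R a) $ i" for i
  proof (cases "\<bar>a $ i\<bar> \<le> \<nu>")
    case True
    have "\<bar>t k * a $ i\<bar> < \<nu>" for k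
    proof -
      have "0 \<le> t k" "t k < 1" by (auto simp: t_def)
      have "\<bar>t k * a $ i\<bar> \<le> t k * \<nu>" using True \<open>0 \<le> t k\<close> by (simp add: abs_mult mult_left_mono)
      also have "t k * \<nu> < 1 * \<nu>" using \<open>t k < 1\<close> \<nu> by (intro mult_strict_right_mono)
      finally show ?thesis by simp
    qed
    with True show ?thesis by simp
  next
    case False
    have "(\<lambda>k. sgn (a $ i) * (t k *\<^sub>R a) $ i) \<longlonglongrightarrow> sgn (a $ i) * (1 *\<^sub>R a) $ i"
      by (intro tendsto_intros tlim)
    moreover have "\<nu> < sgn (a $ i) * (1 *\<^sub>R a) $ i" using False by (simp add: abs_sgn mult.commute)
    ultimately show ?thesis using False order_tendstoD(1) by auto
  qed
  hence "\<forall>\<^sub>F k in sequentially. t k *\<^sub>R a \<in> U"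
    unfolding U_def mem_Collect_eq by (rule eventually_all_finite)
  then obtain n where n: "\<forall>k\<ge>n. t k *\<^sub>R a \<in> U" by (auto simp: eventually_sequentially)
  have "(\<lambda>k. t (k + Suc n) *\<^sub>R a) \<longlonglongrightarrow> 1 *\<^sub>R a"
    by (intro tendsto_intros LIMSEQ_ignore_initial_segment tlim)
  moreover have "p \<in> regular_subdifferential (Phi \<nu>) (t (k + Suc n) *\<^sub>R a)" for k
  proof (rule sub)
    show "0 < t (k + Suc n)" by (simp add: t_def)
    show "t (k + Suc n) *\<^sub>R a \<in> U" using n by simp
  qed
  ultimately show ?thesis unfolding limiting_subdifferential_def
    by (intro CollectI exI[of _ "\<lambda>k. t (k + Suc n) *\<^sub>R a"] exI[of _ "\<lambda>_. p"]) simp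
qed

section \<open>Stationarity of local minimizers\<close>

theorem theorem1:
  fixes G H :: "real^'n \<Rightarrow> real^'m" and \<nu> :: real and xstar :: "real^'n"
  assumes "continuously_differentiable G"
    and "continuously_differentiable H"
    and "feasible_set G H \<noteq> {}"
    and "0 \<notin> feasible_set G H"
    and "\<nu> > 0"
    and "local_minimizer (Phi \<nu>) (feasible_set G H) xstar"
  shows "(limiting_normal_cone (feasible_set G H) xstar = regular_normal_cone (feasible_set G H) xstar
            \<longrightarrow> MPCC_LICQ G H xstar \<longrightarrow> S_stationary \<nu> G H xstar)
       \<and> (MPCC_NNAMCQ G H xstar \<longrightarrow> M_stationary \<nu> G H xstar)
       \<and> (MPCC_LICQ G H xstar \<longrightarrow> d_stationary \<nu> G H xstar)"
proof -
  note G = assms(1) and H = assms(2) and \<nu> = assms(5) and min = assms(6)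
  have x: "xstar \<in> feasible_set G H" using min by (simp add: local_minimizer_def)
  define \<psi> where "\<psi> d y = scaled_l1 \<nu> y - piece_slopes \<nu> d \<bullet> y" for d and y :: "real^'n"
  define d0 where "d0 i = inner_piece \<nu> (xstar $ i)" for i
  have conv: "convex_on UNIV (\<psi> d)" for d
  proof -
    have "convex_on UNIV (\<lambda>y. scaled_l1 \<nu> y + - piece_slopes \<nu> d \<bullet> y)"
      by (intro convex_on_add convex_scaled_l1 convex_on_inner_left \<nu>)
    thus ?thesis by (simp add: \<psi>_def[abs_def])
  qed
  have min\<psi>: "local_minimizer (\<psi> d) (feasible_set G H) xstar"
    if "\<forall>i. d i \<in> active_pieces \<nu> (xstar $ i)" for d
    using piece_majorant_local_minimizer[OF \<nu> min] that by (simp add: \<psi>_def[abs_def])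
  have min0: "local_minimizer (\<psi> d0) (feasible_set G H) xstar"
    using inner_piece_active[OF \<nu>] by (intro min\<psi>) (simp add: d0_def)
  have sub0: "convex_subdifferential (\<psi> d0) xstar \<subseteq> limiting_subdifferential (Phi \<nu>) xstar"
    using subgradient_of_inner_piece[OF \<nu>, of _ xstar] by (auto simp: \<psi>_def[abs_def] d0_def[abs_def])
  have "S_stationary \<nu> G H xstar"
    if regular: "limiting_normal_cone (feasible_set G H) xstar = regular_normal_cone (feasible_set G H) xstar"
      and licq: "MPCC_LICQ G H xstar"
  proof -
    obtain p where p: "p \<in> convex_subdifferential (\<psi> d0) xstar"
      "- p \<in> regular_normal_cone (feasible_set G H) xstar"
      using minimizer_limiting_normal[OF closed_feasible_set[OF G H] conv min0] regular by auto
    obtain u v where uv: "p = multiplier_gradient G H xstar (u, v)"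
      "mpcc_multiplier (\<lambda>s t. 0 \<le> s \<and> 0 \<le> t) G H xstar u v"
      using regular_normal_S_multipliers[OF G H x licq p(2)] by auto
    have "0 \<in> (\<lambda>w. w - nabla G xstar *v u - nabla H xstar *v v) ` limiting_subdifferential (Phi \<nu>) xstar"
      by (rule image_eqI[of _ _ p]) (use p(1) sub0 uv(1) in \<open>auto simp: multiplier_gradient_def\<close>)
    thus ?thesis using x uv(2) unfolding mpcc_multiplier_iff_index_sets[OF x] S_stationary_def by blast
  qed
  moreover have "M_stationary \<nu> G H xstar" if cq: "MPCC_NNAMCQ G H xstar"
  proof -
    obtain u v where uv: "multiplier_gradient G H xstar (u, v) \<in> convex_subdifferential (\<psi> d0) xstar"
      "mpcc_multiplier M_sign G H xstar u v"
      using M_multipliers[OF G H x cq conv min0] by blast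
    have "0 \<in> (\<lambda>w. w - nabla G xstar *v u - nabla H xstar *v v) ` limiting_subdifferential (Phi \<nu>) xstar"
      by (rule image_eqI[OF _ subsetD[OF sub0 uv(1)]]) (simp add: multiplier_gradient_def)
    thus ?thesis using x uv(2) unfolding mpcc_multiplier_iff_index_sets[OF x] M_stationary_def by blast
  qed
  moreover have "d_stationary \<nu> G H xstar" if licq: "MPCC_LICQ G H xstar"
    unfolding d_stationary_def
  proof (intro conjI x allI impI)
    fix d assume d: "\<forall>i. d i \<in> active_pieces \<nu> (xstar $ i)"
    obtain u v where uv: "multiplier_gradient G H xstar (u, v) \<in> convex_subdifferential (\<psi> d) xstar"
      "mpcc_multiplier M_sign G H xstar u v"
      using M_multipliers[OF G H x MPCC_LICQ_imp_NNAMCQ[OF x licq] conv min\<psi>[OF d]] by blast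
    have slopes: "(\<Sum>i\<in>UNIV. deriv (theta \<nu> (d i)) (xstar $ i) *\<^sub>R axis i 1) = piece_slopes \<nu> d"
      by (simp add: vec_eq_iff deriv_theta piece_slopes_def axis_def if_distrib sum.delta cong: if_cong)
    have "multiplier_gradient G H xstar (u, v) + piece_slopes \<nu> d
        \<in> limiting_subdifferential (\<lambda>y. \<Sum>i\<in>UNIV. \<bar>y $ i\<bar> / \<nu>) xstar"
      using uv(1) convex_subdifferential_subset_limiting
      by (auto simp: \<psi>_def[abs_def] convex_subdifferential_minus_inner simp flip: scaled_l1_def)
    hence "0 \<in> (\<lambda>w. w - (\<Sum>i\<in>UNIV. deriv (theta \<nu> (d i)) (xstar $ i) *\<^sub>R axis i 1)
                        - nabla G xstar *v u - nabla H xstar *v v) `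
                  limiting_subdifferential (\<lambda>y. \<Sum>i\<in>UNIV. \<bar>y $ i\<bar> / \<nu>) xstar"
      unfolding slopes by (rule image_eqI[rotated]) (simp add: multiplier_gradient_def)
    moreover have "mpcc_multiplier (\<lambda>s t. 0 \<le> s * t) G H xstar u v"
      using uv(2) by (rule mpcc_multiplier_mono) auto
    ultimately show "\<exists>u v. 0 \<in> (\<lambda>w. w - (\<Sum>i\<in>UNIV. deriv (theta \<nu> (d i)) (xstar $ i) *\<^sub>R axis i 1)
                        - nabla G xstar *v u - nabla H xstar *v v) `
                  limiting_subdifferential (\<lambda>y. \<Sum>i\<in>UNIV. \<bar>y $ i\<bar> / \<nu>) xstar \<and>
          (\<forall>i\<in>I_p0 G H xstar. u $ i = 0) \<and> (\<forall>i\<in>I_0p G H xstar. v $ i = 0) \<and>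
          (\<forall>i\<in>I_00 G H xstar. u $ i * v $ i \<ge> 0)"
      unfolding mpcc_multiplier_iff_index_sets[OF x] by blast
  qed
  ultimately show ?thesis by blast
qed

end
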